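(* Let $\mathcal X$ be a space of homogeneous type with degree $(\alpha_0,n_0,N_0)$, let $\varphi$ be a growth function on $\mathcal X\times[0,\infty)$, and let $\{A_t\}_{t>0}$ be a generalized approximation to the identity such that, for any $t\in(0,\infty)$, $A_t(1)=1$ almost everywhere, namely $\int_{\mathcal X}a_t(x,y)\,d\mu(y)=1$ for almost every $x\in\mathcal X$. Then $\mathrm{BMO}^\varphi(\mathcal X)\subset\mathrm{BMO}^\varphi_A(\mathcal X)$ and there exists a positive constant $C$ such that, for all $f\in\mathrm{BMO}^\varphi(\mathcal X)$, $$\|f\|_{\mathrm{BMO}^\varphi_A(\mathcal X)}\le C\|f\|_{\mathrm{BMO}^\varphi(\mathcal X)}.$$ However, the reverse inequality does not hold true in general: there exist a space of homogeneous type $\mathcal X$, a growth function $\varphi$ on $\mathcal X\times[0,\infty)$ and a generalized approximation to the identity $\{A_t\}_{t>0}$ with $\int_{\mathcal X}a_t(x,y)\,d\mu(y)=1$ for every $t\in(0,\infty)$ and almost every $x\in\mathcal X$, for which there is no constant $C$ with $\|f\|_{\mathrm{BMO}^\varphi(\mathcal X)}\le C\|f\|_{\mathrm{BMO}^\varphi_A(\mathcal X)}$ for all $f\in\mathrm{BMO}^\varphi_A(\mathcal X)$.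
   Context: **Spaces of homogeneous type.** $(\mathcal X,d,\mu)$: $d:\mathcal X\times\mathcal X\to[0,\infty)$ is a quasi-metric ($d(x,y)=0$ iff $x=y$; $d(x,y)=d(y,x)$; $d(x,y)\le C_1[d(x,z)+d(z,y)]$ for a constant $C_1\in[1,\infty)$), and $\mu$ is a nonnegative Borel measure for which there is $C_2\in[1,\infty)$ with $\mu(B(x,2r))\le C_2\mu(B(x,r))<\infty$ for all balls $B(x,r)=\{y: d(y,x)<r\}$ (balls have positive measure). Consider the conditions: ($D_n$), $n\in(0,\infty)$: $\exists C$ with $\mu(B(x,\lambda r))\le C\lambda^n\mu(B(x,r))$ for all $x\in\mathcal X$, $r>0$, $\lambda\ge1$; ($E_N$), $N\in[0,\infty)$: $\exists C$ with $\mu(B(y,r))\le C[1+d(x,y)/r]^N\mu(B(x,r))$ for all $x,y\in\mathcal X$, $r>0$; ($R_\alpha$), $\alpha\in[0,n]$ with $n$ as in ($D_n$): $\exists C\ge1$ with $C^{-1}\lambda^\alpha\mu(B(x,r))\le\mu(B(x,\lambda r))$ for all $x\in\mathcal X$, $r\in(0,2\,\mathrm{diam}(\mathcal X))$, $\lambda\in[1,2\,\mathrm{diam}(\mathcal X)/r)$. Set $n_0=\inf\{n:(D_n)\}$, $N_0=\inf\{N:(E_N)\}$, $\alpha_0=\sup\{\alpha:(R_\alpha)\}$; $(\alpha_0,n_0,N_0)$ is the degree of $\mathcal X$. **Growth functions.** $\varphi:\mathcal X\times[0,\infty)\to[0,\infty)$ is of uniformly upper type $p$ (resp. uniformly lower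 type $p$) if $\exists C$ with $\varphi(x,st)\le Cs^p\varphi(x,t)$ for all $x\in\mathcal X$, $t\ge0$ and $s\ge1$ (resp. $s\in(0,1)$). For $p\in(1,\infty)$, $\varphi\in\mathbb A_p(\mathcal X)$ means $\sup_{t>0}\sup_{B}\frac1{\mu(B)}\int_B\varphi(x,t)\,d\mu(x)\{\frac1{\mu(B)}\int_B[\varphi(x,t)]^{-1/(p-1)}d\mu(x)\}^{p-1}<\infty$; $\varphi\in\mathbb A_1(\mathcal X)$ means $\sup_{t>0}\sup_B\frac1{\mu(B)}\int_B\varphi(x,t)d\mu(x)\,\{\mathrm{ess\,sup}_{y\in B}[\varphi(y,t)]^{-1}\}<\infty$; $\mathbb A_\infty=\bigcup_{p\in[1,\infty)}\mathbb A_p$ (suprema over all balls $B$). $\varphi$ is a growth function if: for each $x$, $\varphi(x,\cdot)$ is an Orlicz function (nondecreasing, $\varphi(x,0)=0$, $\varphi(x,t)>0$ for $t>0$, $\lim_{t\to\infty}\varphi(x,t)=\infty$; not necessarily convex); $\varphi(\cdot,t)$ is measurable for each $t$; $\varphi\in\mathbb A_\infty(\mathcal X)$; and $\varphi$ is of uniformly upper type $1$ and of uniformly lower type $p$ for some $p\in(0,1]$. Indices: $i(\varphi)=\sup\{p\in(0,\infty):\varphi$ is of uniformly lower type $p\}$, $p(\varphi)=\inf\{p\in[1,\infty):\varphi\in\mathbb A_p(\mathcal X)\}$. $\|f\|_{L^\varphi(\mathcal X)}=\inf\{\lambda>0:\int_{\mathcal X}\varphi(x,|f(x)|/\lambda)\,d\mu(x)\le1\}$;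 $\chi_B$ is the characteristic function of $B$. **Generalized approximation to the identity.** Fix $M>n_0[1+p(\varphi)/i(\varphi)]-\alpha_0$, a constant $m>0$, and a positive, bounded, decreasing function $g$ on $[0,\infty)$ with $\lim_{r\to\infty}r^Mg(r^m)=0$. The operators are $A_tf(x)=\int_{\mathcal X}a_t(x,y)f(y)\,d\mu(y)$, $t>0$, with $|a_t(x,y)|\le h_t(x,y):=\frac1{\mu(B(x,t^{1/m}))}g\big(\frac{[d(x,y)]^m}{t}\big)$ for all $x,y\in\mathcal X$. They act on $f\in\mathcal M(\mathcal X):=\bigcup_{x_0\in\mathcal X}\bigcup_{\{\beta:\,0<\beta<M-n_0-N_0\}}\mathcal M_{(x_0,\beta)}(\mathcal X)$, where $\mathcal M_{(x_0,\beta)}(\mathcal X)$ is the set of $f\in L^1_{\rm loc}(\mathcal X)$ with $\int_{\mathcal X}\frac{|f(x)|}{[1+d(x_0,x)]^{n_0p(\varphi)/i(\varphi)-\alpha_0+\beta}\,\mu(B(x_0,1+d(x_0,x)))}\,d\mu(x)<\infty$. **Spaces.** $\mathrm{BMO}^\varphi(\mathcal X)$: locally integrable $f$ with $\|f\|_{\mathrm{BMO}^\varphi(\mathcal X)}=\sup_B\frac1{\|\chi_B\|_{L^\varphi(\mathcal X)}}\int_B|f(x)-f_B|\,d\mu(x)<\infty$, $f_B=\frac1{\mu(B)}\int_Bf\,d\mu$ (the norm is $\infty$ for locally integrable $f$ outside the space). $\mathrm{BMO}^\varphi_A(\mathcal X)$: $f\in\mathcal M(\mathcal X)$ with $\|f\|_{\mathrm{BMO}^\varphi_A(\mathcal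 X)}=\sup_B\frac1{\|\chi_B\|_{L^\varphi(\mathcal X)}}\int_B|f(x)-A_{t_B}f(x)|\,d\mu(x)<\infty$, with $t_B:=r_B^m$, $r_B$ the radius of $B$. Suprema are over all balls. *)

theory Defs
  imports "HOL-Analysis.Analysis" "HOL-Probability.Essential_Supremum"
begin

section \<open>Spaces of homogeneous type\<close>

text \<open>The underlying set is \<open>space \<mu>\<close>, a subset of the ambient type.\<close>

definition qball :: "'a measure \<Rightarrow> ('a \<Rightarrow> 'a \<Rightarrow> real) \<Rightarrow> 'a \<Rightarrow> real \<Rightarrow> 'a set" where
  "qball \<mu> d x r = {y \<in> space \<mu>. d y x < r}"

definition quasi_metric_on :: "'a set \<Rightarrow> ('a \<Rightarrow> 'a \<Rightarrow> real) \<Rightarrow> bool" where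
  "quasi_metric_on X d \<longleftrightarrow>
     (\<forall>x\<in>X. \<forall>y\<in>X. 0 \<le> d x y \<and> (d x y = 0 \<longleftrightarrow> x = y) \<and> d x y = d y x) \<and>
     (\<exists>C\<^sub>1\<ge>1. \<forall>x\<in>X. \<forall>y\<in>X. \<forall>z\<in>X. d x y \<le> C\<^sub>1 * (d x z + d z y))"

definition quasi_metric_open :: "'a measure \<Rightarrow> ('a \<Rightarrow> 'a \<Rightarrow> real) \<Rightarrow> 'a set \<Rightarrow> bool" where
  "quasi_metric_open \<mu> d U \<longleftrightarrow>
     U \<subseteq> space \<mu> \<and> (\<forall>x\<in>U. \<exists>r>0. qball \<mu> d x r \<subseteq> U)"

text \<open>Balls of a quasi-metric need not be open, nor even Borel, in the topology it induces;
  their measurability, which is implicit in writing \<open>\<mu>(B)\<close>, is therefore required explicitly.\<close>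

definition homogeneous_type :: "'a measure \<Rightarrow> ('a \<Rightarrow> 'a \<Rightarrow> real) \<Rightarrow> bool" where
  "homogeneous_type \<mu> d \<longleftrightarrow>
     space \<mu> \<noteq> {} \<and>
     quasi_metric_on (space \<mu>) d \<and>
     sets \<mu> = sigma_sets (space \<mu>) {U. quasi_metric_open \<mu> d U} \<and>
     (\<forall>x\<in>space \<mu>. \<forall>r>0. qball \<mu> d x r \<in> sets \<mu> \<and>
        0 < emeasure \<mu> (qball \<mu> d x r) \<and> emeasure \<mu> (qball \<mu> d x r) < \<infinity>) \<and>
     (\<exists>C\<^sub>2\<ge>1. \<forall>x\<in>space \<mu>. \<forall>r>0.
        emeasure \<mu> (qball \<mu> d x (2 * r)) \<le> ennreal C\<^sub>2 * emeasure \<mu> (qball \<mu> d x r))"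

definition cond_D :: "'a measure \<Rightarrow> ('a \<Rightarrow> 'a \<Rightarrow> real) \<Rightarrow> real \<Rightarrow> bool" where
  "cond_D \<mu> d n \<longleftrightarrow>
     (\<exists>C. \<forall>x\<in>space \<mu>. \<forall>r>0. \<forall>l\<ge>1.
        measure \<mu> (qball \<mu> d x (l * r)) \<le> C * l powr n * measure \<mu> (qball \<mu> d x r))"

definition cond_E :: "'a measure \<Rightarrow> ('a \<Rightarrow> 'a \<Rightarrow> real) \<Rightarrow> real \<Rightarrow> bool" where
  "cond_E \<mu> d N \<longleftrightarrow>
     (\<exists>C. \<forall>x\<in>space \<mu>. \<forall>y\<in>space \<mu>. \<forall>r>0.
        measure \<mu> (qball \<mu> d y r) \<le> C * (1 + d x y / r) powr N * measure \<mu> (qball \<mu> d x r))"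

definition qdiam :: "'a measure \<Rightarrow> ('a \<Rightarrow> 'a \<Rightarrow> real) \<Rightarrow> ereal" where
  "qdiam \<mu> d = (SUP x\<in>space \<mu>. SUP y\<in>space \<mu>. ereal (d x y))"

definition cond_R :: "'a measure \<Rightarrow> ('a \<Rightarrow> 'a \<Rightarrow> real) \<Rightarrow> real \<Rightarrow> bool" where
  "cond_R \<mu> d \<alpha> \<longleftrightarrow>
     (\<exists>C\<ge>1. \<forall>x\<in>space \<mu>. \<forall>r l. 0 < r \<and> ereal r < 2 * qdiam \<mu> d \<and>
        1 \<le> l \<and> ereal l < 2 * qdiam \<mu> d / ereal r \<longrightarrow>
        inverse C * l powr \<alpha> * measure \<mu> (qball \<mu> d x r) \<le> measure \<mu> (qball \<mu> d x (l * r)))"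

definition deg_n :: "'a measure \<Rightarrow> ('a \<Rightarrow> 'a \<Rightarrow> real) \<Rightarrow> real" where
  "deg_n \<mu> d = Inf {n. 0 < n \<and> cond_D \<mu> d n}"

definition deg_N :: "'a measure \<Rightarrow> ('a \<Rightarrow> 'a \<Rightarrow> real) \<Rightarrow> real" where
  "deg_N \<mu> d = Inf {N. 0 \<le> N \<and> cond_E \<mu> d N}"

text \<open>The restriction \<open>\<alpha> \<in> [0,n]\<close> is imposed for every \<open>n\<close> satisfying \<open>(D\<^sub>n)\<close>. With at least two
  points it is a consequence of \<open>(R\<^sub>\<alpha>)\<close> and \<open>(D\<^sub>n)\<close>; for a one-point space \<open>(R\<^sub>\<alpha>)\<close> is vacuous, and
  it makes the supremum \<open>0\<close>.\<close>

definition deg_\<alpha> :: "'a measure \<Rightarrow> ('a \<Rightarrow> 'a \<Rightarrow> real) \<Rightarrow> real" where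
  "deg_\<alpha> \<mu> d = Sup {\<alpha>. 0 \<le> \<alpha> \<and> (\<forall>n>0. cond_D \<mu> d n \<longrightarrow> \<alpha> \<le> n) \<and> cond_R \<mu> d \<alpha>}"

section \<open>Growth functions\<close>

definition upper_type :: "'a measure \<Rightarrow> ('a \<Rightarrow> real \<Rightarrow> real) \<Rightarrow> real \<Rightarrow> bool" where
  "upper_type \<mu> \<phi> p \<longleftrightarrow>
     (\<exists>C. \<forall>x\<in>space \<mu>. \<forall>t\<ge>0. \<forall>s\<ge>1. \<phi> x (s * t) \<le> C * s powr p * \<phi> x t)"

definition lower_type :: "'a measure \<Rightarrow> ('a \<Rightarrow> real \<Rightarrow> real) \<Rightarrow> real \<Rightarrow> bool" where
  "lower_type \<mu> \<phi> p \<longleftrightarrow>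
     (\<exists>C. \<forall>x\<in>space \<mu>. \<forall>t\<ge>0. \<forall>s\<in>{0<..<1}. \<phi> x (s * t) \<le> C * s powr p * \<phi> x t)"

definition orlicz :: "(real \<Rightarrow> real) \<Rightarrow> bool" where
  "orlicz \<Phi> \<longleftrightarrow>
     mono_on {0..} \<Phi> \<and> \<Phi> 0 = 0 \<and> (\<forall>t>0. 0 < \<Phi> t) \<and> filterlim \<Phi> at_top at_top"

text \<open>Powers of extended nonnegative numbers, for exponents \<open>s > 0\<close>.\<close>

definition ennreal_powr :: "ennreal \<Rightarrow> real \<Rightarrow> ennreal" where
  "ennreal_powr u s = (if u = \<infinity> then \<infinity> else ennreal (enn2real u powr s))"

definition nn_average :: "'a measure \<Rightarrow> 'a set \<Rightarrow> ('a \<Rightarrow> ennreal) \<Rightarrow> ennreal" where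
  "nn_average \<mu> B f = (\<integral>\<^sup>+x\<in>B. f x \<partial>\<mu>) / emeasure \<mu> B"

text \<open>Only used for \<open>\<phi>\<close> with \<open>\<phi>(x,t) > 0\<close> for \<open>t > 0\<close>, so the real powers and inverses below
  are those of positive numbers.\<close>

definition muckenhoupt ::
  "'a measure \<Rightarrow> ('a \<Rightarrow> 'a \<Rightarrow> real) \<Rightarrow> real \<Rightarrow> ('a \<Rightarrow> real \<Rightarrow> real) \<Rightarrow> bool" where
  "muckenhoupt \<mu> d p \<phi> \<longleftrightarrow>
     (SUP t\<in>{0<..}. SUP x\<in>space \<mu>. SUP r\<in>{0<..}.
        nn_average \<mu> (qball \<mu> d x r) (\<lambda>y. ennreal (\<phi> y t)) *
        (if p = 1
         then esssup (restrict_space \<mu> (qball \<mu> d x r)) (\<lambda>y. ennreal (inverse (\<phi> y t)))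
         else ennreal_powr
                (nn_average \<mu> (qball \<mu> d x r) (\<lambda>y. ennreal (\<phi> y t powr (- 1 / (p - 1)))))
                (p - 1)))
     < \<infinity>"

definition growth_function ::
  "'a measure \<Rightarrow> ('a \<Rightarrow> 'a \<Rightarrow> real) \<Rightarrow> ('a \<Rightarrow> real \<Rightarrow> real) \<Rightarrow> bool" where
  "growth_function \<mu> d \<phi> \<longleftrightarrow>
     (\<forall>x\<in>space \<mu>. orlicz (\<phi> x)) \<and>
     (\<forall>t\<ge>0. (\<lambda>x. \<phi> x t) \<in> borel_measurable \<mu>) \<and>
     (\<exists>p\<ge>1. muckenhoupt \<mu> d p \<phi>) \<and>
     upper_type \<mu> \<phi> 1 \<and>
     (\<exists>p\<in>{0<..1}. lower_type \<mu> \<phi> p)"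

definition lower_index :: "'a measure \<Rightarrow> ('a \<Rightarrow> real \<Rightarrow> real) \<Rightarrow> real" where
  "lower_index \<mu> \<phi> = Sup {p. 0 < p \<and> lower_type \<mu> \<phi> p}"

definition weight_index ::
  "'a measure \<Rightarrow> ('a \<Rightarrow> 'a \<Rightarrow> real) \<Rightarrow> ('a \<Rightarrow> real \<Rightarrow> real) \<Rightarrow> real" where
  "weight_index \<mu> d \<phi> = Inf {p. 1 \<le> p \<and> muckenhoupt \<mu> d p \<phi>}"

definition luxemburg_norm ::
  "'a measure \<Rightarrow> ('a \<Rightarrow> real \<Rightarrow> real) \<Rightarrow> ('a \<Rightarrow> real) \<Rightarrow> ennreal" where
  "luxemburg_norm \<mu> \<phi> f =
     Inf {ennreal l | l. 0 < l \<and> (\<integral>\<^sup>+x. ennreal (\<phi> x (\<bar>f x\<bar> / l)) \<partial>\<mu>) \<le> 1}"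

section \<open>Generalized approximations to the identity\<close>

text \<open>Functions and kernels take values in a scalar field \<open>'k\<close> of the classes
  \<open>real_normed_field\<close>, \<open>banach\<close>, \<open>second_countable_topology\<close>, instances of which are \<open>real\<close> and
  \<open>complex\<close>.\<close>

definition critical_index ::
  "'a measure \<Rightarrow> ('a \<Rightarrow> 'a \<Rightarrow> real) \<Rightarrow> ('a \<Rightarrow> real \<Rightarrow> real) \<Rightarrow> real" where
  "critical_index \<mu> d \<phi> =
     deg_n \<mu> d * (1 + weight_index \<mu> d \<phi> / lower_index \<mu> \<phi>) - deg_\<alpha> \<mu> d"

definition generalized_approx_identity ::
  "'a measure \<Rightarrow> ('a \<Rightarrow> 'a \<Rightarrow> real) \<Rightarrow> ('a \<Rightarrow> real \<Rightarrow> real) \<Rightarrow> real \<Rightarrow> real \<Rightarrow> (real \<Rightarrow> real) \<Rightarrow>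
   (real \<Rightarrow> 'a \<Rightarrow> 'a \<Rightarrow> 'k::{real_normed_field,banach,second_countable_topology}) \<Rightarrow> bool" where
  "generalized_approx_identity \<mu> d \<phi> M m g a \<longleftrightarrow>
     M > critical_index \<mu> d \<phi> \<and>
     m > 0 \<and>
     (\<forall>r\<ge>0. 0 < g r) \<and> bounded (g ` {0..}) \<and> antimono_on {0..} g \<and>
     ((\<lambda>r. r powr M * g (r powr m)) \<longlongrightarrow> 0) at_top \<and>
     (\<forall>t>0. (\<lambda>(x, y). a t x y) \<in> borel_measurable (\<mu> \<Otimes>\<^sub>M \<mu>)) \<and>
     (\<forall>t>0. \<forall>x\<in>space \<mu>. \<forall>y\<in>space \<mu>.
        norm (a t x y) \<le> g (d x y powr m / t) / measure \<mu> (qball \<mu> d x (t powr (1 / m))))"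

definition approx_op ::
  "'a measure \<Rightarrow> (real \<Rightarrow> 'a \<Rightarrow> 'a \<Rightarrow> 'k::{real_normed_field,banach,second_countable_topology}) \<Rightarrow>
   real \<Rightarrow> ('a \<Rightarrow> 'k) \<Rightarrow> 'a \<Rightarrow> 'k" where
  "approx_op \<mu> a t f x = (LINT y|\<mu>. a t x y * f y)"

definition locally_integrable ::
  "'a measure \<Rightarrow> ('a \<Rightarrow> 'a \<Rightarrow> real) \<Rightarrow>
   ('a \<Rightarrow> 'k::{real_normed_field,banach,second_countable_topology}) \<Rightarrow> bool" where
  "locally_integrable \<mu> d f \<longleftrightarrow>
     (\<forall>x\<in>space \<mu>. \<forall>r>0. set_integrable \<mu> (qball \<mu> d x r) f)"

definition growth_class_at ::
  "'a measure \<Rightarrow> ('a \<Rightarrow> 'a \<Rightarrow> real) \<Rightarrow> ('a \<Rightarrow> real \<Rightarrow> real) \<Rightarrow> 'a \<Rightarrow> real \<Rightarrow>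
   ('a \<Rightarrow> 'k::{real_normed_field,banach,second_countable_topology}) set" where
  "growth_class_at \<mu> d \<phi> x\<^sub>0 \<beta> =
     {f. locally_integrable \<mu> d f \<and>
         (\<integral>\<^sup>+x. ennreal (norm (f x) /
            ((1 + d x\<^sub>0 x) powr
               (deg_n \<mu> d * weight_index \<mu> d \<phi> / lower_index \<mu> \<phi> - deg_\<alpha> \<mu> d + \<beta>) *
             measure \<mu> (qball \<mu> d x\<^sub>0 (1 + d x\<^sub>0 x)))) \<partial>\<mu>) < \<infinity>}"

definition growth_class ::
  "'a measure \<Rightarrow> ('a \<Rightarrow> 'a \<Rightarrow> real) \<Rightarrow> ('a \<Rightarrow> real \<Rightarrow> real) \<Rightarrow> real \<Rightarrow>
   ('a \<Rightarrow> 'k::{real_normed_field,banach,second_countable_topology}) set" where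
  "growth_class \<mu> d \<phi> M =
     (\<Union>x\<^sub>0\<in>space \<mu>. \<Union>\<beta>\<in>{0<..<M - deg_n \<mu> d - deg_N \<mu> d}. growth_class_at \<mu> d \<phi> x\<^sub>0 \<beta>)"

section \<open>The spaces\<close>

definition mean ::
  "'a measure \<Rightarrow> 'a set \<Rightarrow>
   ('a \<Rightarrow> 'k::{real_normed_field,banach,second_countable_topology}) \<Rightarrow> 'k" where
  "mean \<mu> B f = (LINT x:B|\<mu>. f x) /\<^sub>R measure \<mu> B"

definition BMO_norm ::
  "'a measure \<Rightarrow> ('a \<Rightarrow> 'a \<Rightarrow> real) \<Rightarrow> ('a \<Rightarrow> real \<Rightarrow> real) \<Rightarrow>
   ('a \<Rightarrow> 'k::{real_normed_field,banach,second_countable_topology}) \<Rightarrow> ennreal" where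
  "BMO_norm \<mu> d \<phi> f =
     (SUP x\<in>space \<mu>. SUP r\<in>{0<..}.
        (\<integral>\<^sup>+y\<in>qball \<mu> d x r. ennreal (norm (f y - mean \<mu> (qball \<mu> d x r) f)) \<partial>\<mu>) /
        luxemburg_norm \<mu> \<phi> (indicator (qball \<mu> d x r)))"

definition BMO ::
  "'a measure \<Rightarrow> ('a \<Rightarrow> 'a \<Rightarrow> real) \<Rightarrow> ('a \<Rightarrow> real \<Rightarrow> real) \<Rightarrow>
   ('a \<Rightarrow> 'k::{real_normed_field,banach,second_countable_topology}) set" where
  "BMO \<mu> d \<phi> = {f. locally_integrable \<mu> d f \<and> BMO_norm \<mu> d \<phi> f < \<infinity>}"

definition BMO_A_norm ::
  "'a measure \<Rightarrow> ('a \<Rightarrow> 'a \<Rightarrow> real) \<Rightarrow> ('a \<Rightarrow> real \<Rightarrow> real) \<Rightarrow> real \<Rightarrow>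
   (real \<Rightarrow> 'a \<Rightarrow> 'a \<Rightarrow> 'k::{real_normed_field,banach,second_countable_topology}) \<Rightarrow>
   ('a \<Rightarrow> 'k) \<Rightarrow> ennreal" where
  "BMO_A_norm \<mu> d \<phi> m a f =
     (SUP x\<in>space \<mu>. SUP r\<in>{0<..}.
        (\<integral>\<^sup>+y\<in>qball \<mu> d x r. ennreal (norm (f y - approx_op \<mu> a (r powr m) f y)) \<partial>\<mu>) /
        luxemburg_norm \<mu> \<phi> (indicator (qball \<mu> d x r)))"

text \<open>The Bochner integral of a non-integrable function is \<open>0\<close> by convention. The integrability
  clause says that \<open>A\<^sub>t f\<close> is actually defined almost everywhere, as the norm presupposes.\<close>

definition BMO_A ::
  "'a measure \<Rightarrow> ('a \<Rightarrow> 'a \<Rightarrow> real) \<Rightarrow> ('a \<Rightarrow> real \<Rightarrow> real) \<Rightarrow> real \<Rightarrow> real \<Rightarrow>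
   (real \<Rightarrow> 'a \<Rightarrow> 'a \<Rightarrow> 'k::{real_normed_field,banach,second_countable_topology}) \<Rightarrow>
   ('a \<Rightarrow> 'k) set" where
  "BMO_A \<mu> d \<phi> M m a =
     {f \<in> growth_class \<mu> d \<phi> M.
        (\<forall>t>0. AE x in \<mu>. integrable \<mu> (\<lambda>y. a t x y * f y)) \<and>
        BMO_A_norm \<mu> d \<phi> m a f < \<infinity>}"

end

theory Submission
  imports Defs
begin

text \<open>
  Fix a ball \<open>B = B(x,r)\<close> with dyadic dilates \<open>B\<^sub>k = B(x,2\<^sup>kr)\<close> and exponents \<open>n, \<alpha>, q, p\<close> close to
  \<open>n\<^sub>0, \<alpha>\<^sub>0, p(\<phi>), i(\<phi>)\<close>. The \<open>A\<^sub>q\<close> condition and the lower type bound \<open>\<parallel>\<chi>\<^bsub>B\<^sub>k\<^esub>\<parallel>\<close> by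
  \<open>2\<^bsup>knq/p\<^esup>\<parallel>\<chi>\<^sub>B\<parallel>\<close>, so with the reverse doubling condition \<open>\<parallel>\<chi>\<^bsub>B\<^sub>k\<^esub>\<parallel>/\<mu>(B\<^sub>k)\<close> grows at most like
  \<open>2\<^bsup>ke\<^esup>\<close> with \<open>e\<close> close to \<open>n\<^sub>0p(\<phi>)/i(\<phi>) - \<alpha>\<^sub>0\<close>. Telescoping the means of \<open>f \<in> BMO\<^sup>\<phi>\<close> over
  the \<open>B\<^sub>k\<close>, the average of \<open>|f - f\<^sub>B|\<close> over \<open>B\<^sub>k\<close> obeys the same bound. The kernel is of size
  \<open>2\<^bsup>-kM\<^esup>/\<mu>(B)\<close> off \<open>B\<^bsub>k-1\<^esub>\<close>, so \<open>|A\<^sub>t(f - f\<^sub>B)|\<close> is at most a constant times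
  \<open>\<parallel>f\<parallel> \<parallel>\<chi>\<^sub>B\<parallel>/\<mu>(B)\<close> on \<open>B\<close> because \<open>n + e < M\<close>, and \<open>A\<^sub>t(f - f\<^sub>B) = A\<^sub>tf - f\<^sub>B\<close> almost everywhere.
  That \<open>f\<close> lies in the class \<open>\<M>(\<X>)\<close> follows from the same bound; the range of \<open>\<beta>\<close> is
  nonempty since \<open>(D\<^sub>n)\<close> and \<open>(R\<^sub>\<alpha>)\<close> imply \<open>(E\<^bsub>n-\<alpha>\<^esub>)\<close>.

  The reverse inequality already fails on a two-point space, where the identity operators form a
  generalized approximation to the identity, so that \<open>\<parallel>f\<parallel> = 0\<close> in \<open>BMO\<^sup>\<phi>\<^sub>A\<close> for every \<open>f\<close>.
\<close>

section \<open>Spaces of homogeneous type\<close>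

locale homogeneous_space =
  fixes \<mu> :: "'a measure" and d :: "'a \<Rightarrow> 'a \<Rightarrow> real"
  assumes homogeneous: "homogeneous_type \<mu> d"
begin

abbreviation B :: "'a \<Rightarrow> real \<Rightarrow> 'a set" where
  "B \<equiv> qball \<mu> d"

definition V :: "'a \<Rightarrow> real \<Rightarrow> real" where
  "V x r = measure \<mu> (B x r)"

lemma space_nonempty: "space \<mu> \<noteq> {}"
  using homogeneous by (simp add: homogeneous_type_def)

lemma dist_nonneg: "x \<in> space \<mu> \<Longrightarrow> y \<in> space \<mu> \<Longrightarrow> 0 \<le> d x y"
  and dist_self: "x \<in> space \<mu> \<Longrightarrow> d x x = 0"
  and dist_sym: "x \<in> space \<mu> \<Longrightarrow> y \<in> space \<mu> \<Longrightarrow> d x y = d y x"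
  using homogeneous by (auto simp: homogeneous_type_def quasi_metric_on_def)

lemma ball_in_space: "y \<in> B x r \<Longrightarrow> y \<in> space \<mu>"
  by (simp add: qball_def)

lemma center_in_ball: "x \<in> space \<mu> \<Longrightarrow> 0 < r \<Longrightarrow> x \<in> B x r"
  by (simp add: qball_def dist_self)

lemma quasi_triangle:
  "\<exists>C\<ge>1. \<forall>x\<in>space \<mu>. \<forall>y\<in>space \<mu>. \<forall>z\<in>space \<mu>. d x y \<le> C * (d x z + d z y)"
  using homogeneous unfolding homogeneous_type_def quasi_metric_on_def by blast

lemma sets_ball: "x \<in> space \<mu> \<Longrightarrow> r > 0 \<Longrightarrow> B x r \<in> sets \<mu>"
  and emeasure_ball_pos: "x \<in> space \<mu> \<Longrightarrow> r > 0 \<Longrightarrow> 0 < emeasure \<mu> (B x r)"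
  and emeasure_ball_finite: "x \<in> space \<mu> \<Longrightarrow> r > 0 \<Longrightarrow> emeasure \<mu> (B x r) < \<infinity>"
  using homogeneous unfolding homogeneous_type_def by blast+

lemma emeasure_ball: "x \<in> space \<mu> \<Longrightarrow> r > 0 \<Longrightarrow> emeasure \<mu> (B x r) = ennreal (V x r)"
  using emeasure_ball_finite[of x r] unfolding V_def
  by (intro emeasure_eq_ennreal_measure) auto

lemma V_pos: "x \<in> space \<mu> \<Longrightarrow> r > 0 \<Longrightarrow> 0 < V x r"
  using emeasure_ball_pos[of x r] emeasure_ball[of x r] by simp

lemma V_mono_subset:
  assumes "x \<in> space \<mu>" "y \<in> space \<mu>" "r > 0" "s > 0" "B x r \<subseteq> B y s"
  shows "V x r \<le> V y s"
  using emeasure_mono[OF assms(5) sets_ball[OF assms(2,4)]] assms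
  by (simp add: emeasure_ball V_pos less_imp_le)

lemma ball_mono: "r \<le> s \<Longrightarrow> B x r \<subseteq> B x s"
  by (auto simp: qball_def)

lemma V_mono: "x \<in> space \<mu> \<Longrightarrow> 0 < r \<Longrightarrow> r \<le> s \<Longrightarrow> V x r \<le> V x s"
  by (intro V_mono_subset ball_mono) auto

lemma V_doubling: "\<exists>C\<ge>1. \<forall>x\<in>space \<mu>. \<forall>r>0. V x (2 * r) \<le> C * V x r"
proof -
  obtain C where C: "C \<ge> 1" "\<forall>x\<in>space \<mu>. \<forall>r>0.
        emeasure \<mu> (B x (2 * r)) \<le> ennreal C * emeasure \<mu> (B x r)"
    using homogeneous unfolding homogeneous_type_def by blast
  have "V x (2 * r) \<le> C * V x r" if "x \<in> space \<mu>" "r > 0" for x r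
  proof -
    have "ennreal (V x (2 * r)) \<le> ennreal (C * V x r)"
      using C(1) C(2)[rule_format, OF that] emeasure_ball[OF that] emeasure_ball[of x "2 * r"]
        that V_pos[OF that]
      by (simp add: ennreal_mult')
    then show ?thesis
      using C(1) V_pos[OF that] by (simp add: ennreal_le_iff)
  qed
  with C(1) show ?thesis by blast
qed

text \<open>This trades one centre for another at the price of a constant factor in the radius. The
  factor is \<open>2 * C\<close>: the quasi-triangle inequality bounds \<open>d z y\<close> by
  \<open>C\<close> times a sum of two terms, each at most \<open>r\<close>.\<close>

lemma ball_subset_ball:
  "\<exists>C\<ge>1. \<forall>x\<in>space \<mu>. \<forall>y\<in>space \<mu>. \<forall>r. d x y \<le> r \<longrightarrow> B x r \<subseteq> B y (C * r)"
proof -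
  obtain C where C: "C \<ge> 1"
    "\<forall>x\<in>space \<mu>. \<forall>y\<in>space \<mu>. \<forall>z\<in>space \<mu>. d x y \<le> C * (d x z + d z y)"
    using quasi_triangle by blast
  have "B x r \<subseteq> B y (2 * C * r)"
    if xy: "x \<in> space \<mu>" "y \<in> space \<mu>" "d x y \<le> r" for x y r
  proof
    fix z assume z: "z \<in> B x r"
    then have "d z y \<le> C * (d z x + d x y)"
      using C(2) xy by (auto simp: qball_def)
    also have "\<dots> < C * (r + r)"
      using z xy C(1) by (intro mult_strict_left_mono) (auto simp: qball_def)
    finally show "z \<in> B y (2 * C * r)"
      using z by (auto simp: qball_def)
  qed
  with C(1) show ?thesis
    by (intro exI[of _ "2 * C"]) auto
qed

section \<open>The conditions (D), (R), (E) and the degree of the space\<close>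

lemma cond_D_iff:
  "cond_D \<mu> d n \<longleftrightarrow>
     (\<exists>C>0. \<forall>x\<in>space \<mu>. \<forall>r>0. \<forall>l\<ge>1. V x (l * r) \<le> C * l powr n * V x r)"
proof
  assume "cond_D \<mu> d n"
  then obtain C where C: "\<forall>x\<in>space \<mu>. \<forall>r>0. \<forall>l\<ge>1. V x (l * r) \<le> C * l powr n * V x r"
    unfolding cond_D_def V_def by blast
  have "V x (l * r) \<le> max C 1 * l powr n * V x r" if "x \<in> space \<mu>" "r > 0" "l \<ge> 1" for x r l
  proof -
    have "C * (l powr n * V x r) \<le> max C 1 * (l powr n * V x r)"
      using V_pos[OF that(1,2)] by (intro mult_right_mono) auto
    then show ?thesis
      using C that by (smt (verit) mult.assoc)
  qed
  then show "\<exists>C>0. \<forall>x\<in>space \<mu>. \<forall>r>0. \<forall>l\<ge>1. V x (l * r) \<le> C * l powr n * V x r"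
    by (intro exI[of _ "max C 1"]) auto
qed (auto simp: cond_D_def V_def)

text \<open>Doubling is iterated along powers of two: for
  \<open>2 ^ k \<le> l \<le> 2 ^ Suc k\<close> the loss is \<open>C ^ Suc k\<close>, and
  \<open>C ^ k\<close> is at most \<open>l powr n\<close> because \<open>C \<le> 2 powr n\<close>.
  Hence \<open>deg_n\<close> is the infimum of a nonempty set.\<close>

lemma cond_D_exists: "\<exists>n>0. cond_D \<mu> d n"
proof -
  obtain C where C: "C \<ge> 1" "\<forall>x\<in>space \<mu>. \<forall>r>0. V x (2 * r) \<le> C * V x r"
    using V_doubling by blast
  \<comment> \<open>The summand 1 keeps the exponent positive when the doubling constant is
    1.\<close>
  define n where "n = log 2 C + 1"
  have Cn: "C \<le> 2 powr n" and n: "n > 0"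
    using C(1) by (auto simp: n_def powr_add zero_le_log_cancel_iff add_nonneg_pos)
  have pow: "V x (2 ^ k * r) \<le> C ^ k * V x r" if x: "x \<in> space \<mu>" "r > 0" for x r and k :: nat
  proof (induction k)
    case (Suc k)
    have "V x (2 ^ Suc k * r) \<le> C * V x (2 ^ k * r)"
      using C(2)[rule_format, of x "2 ^ k * r"] x by (simp add: mult.assoc)
    also have "\<dots> \<le> C * (C ^ k * V x r)"
      using Suc C(1) by (intro mult_left_mono) auto
    finally show ?case by (simp add: mult.assoc)
  qed simp
  have "V x (l * r) \<le> C * l powr n * V x r" if x: "x \<in> space \<mu>" "r > 0" "l \<ge> 1" for x r l
  proof -
    define k where "k = nat \<lfloor>log 2 l\<rfloor>"
    have "0 \<le> log 2 l"
      using x(3) by simp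
    then have k: "real k \<le> log 2 l" "log 2 l \<le> real (Suc k)"
      unfolding k_def by linarith+
    have kl: "2 ^ k \<le> l" "l \<le> 2 ^ Suc k"
      using k x(3) le_log_iff[of 2 l k] log_le_iff[of 2 l "Suc k"]
      by (simp_all add: powr_realpow del: power_Suc of_nat_Suc)
    have "V x (l * r) \<le> V x (2 ^ Suc k * r)"
      using kl x by (intro V_mono mult_right_mono) auto
    also have "\<dots> \<le> C ^ Suc k * V x r"
      by (rule pow[OF x(1,2)])
    also have "C ^ Suc k \<le> C * (2 powr n) ^ k"
      using Cn C(1) by (auto intro!: mult_left_mono power_mono)
    also have "(2 powr n) ^ k = (2 ^ k :: real) powr n"
      by (simp add: powr_powr powr_realpow[symmetric] powr_power mult.commute)
    also have "\<dots> \<le> l powr n"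
      using kl n by (intro powr_mono2) auto
    finally show ?thesis
      using C(1) V_pos[OF x(1,2)] by (simp add: mult_left_mono mult_right_mono)
  qed
  then have "cond_D \<mu> d n"
    unfolding cond_D_def V_def by blast
  with n show ?thesis by blast
qed

lemma deg_n_nonneg: "0 \<le> deg_n \<mu> d"
  unfolding deg_n_def using cond_D_exists by (intro cInf_greatest) auto

text \<open>The infimum need not be attained, so all estimates use exponents close to the degree.
  The corresponding lemmas for \<alpha>, the lower type and the weight class serve the same
  purpose.\<close>

lemma deg_n_approx:
  assumes "deg_n \<mu> d < c"
  obtains n where "0 < n" "cond_D \<mu> d n" "n < c"
  using assms cond_D_exists cInf_lessD[of "{n. 0 < n \<and> cond_D \<mu> d n}" c]
  unfolding deg_n_def by blast

lemma cond_R_0: "cond_R \<mu> d 0"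
  unfolding cond_R_def
  using V_mono[unfolded V_def] by (intro exI[of _ 1]) (auto simp: mult_le_cancel_right1)

lemma deg_\<alpha>_approx:
  assumes "c < deg_\<alpha> \<mu> d"
  obtains \<alpha> where "0 \<le> \<alpha>" "\<And>n. 0 < n \<Longrightarrow> cond_D \<mu> d n \<Longrightarrow> \<alpha> \<le> n" "cond_R \<mu> d \<alpha>" "c < \<alpha>"
proof -
  define S where "S = {\<alpha>. 0 \<le> \<alpha> \<and> (\<forall>n>0. cond_D \<mu> d n \<longrightarrow> \<alpha> \<le> n) \<and> cond_R \<mu> d \<alpha>}"
  have "0 \<in> S"
    using cond_R_0 by (simp add: S_def)
  moreover have "c < Sup S"
    using assms by (simp add: deg_\<alpha>_def S_def)
  ultimately obtain \<alpha> where "\<alpha> \<in> S" "c < \<alpha>"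
    using less_cSupE by blast
  then show thesis
    using that[of \<alpha>] by (simp add: S_def)
qed

lemma dist_le_qdiam: "x \<in> space \<mu> \<Longrightarrow> y \<in> space \<mu> \<Longrightarrow> ereal (d x y) \<le> qdiam \<mu> d"
  unfolding qdiam_def by (meson SUP_upper2 order_refl)

text \<open>This form of reverse doubling is free of the diameter. A radius that is the distance of
  two actual points is at most the diameter, hence strictly below twice the diameter, so both range
  conditions on \<open>r\<close> and \<open>l\<close> hold automatically.\<close>

lemma cond_R_dist:
  assumes "cond_R \<mu> d \<alpha>"
  shows "\<exists>C\<ge>1. \<forall>x\<in>space \<mu>. \<forall>y\<in>space \<mu>. \<forall>z\<in>space \<mu>. \<forall>r>0. r \<le> d y z \<longrightarrow>
      (d y z / r) powr \<alpha> * V x r \<le> C * V x (d y z)"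
proof -
  obtain C where C: "C \<ge> 1" "\<forall>x\<in>space \<mu>. \<forall>r l. 0 < r \<and> ereal r < 2 * qdiam \<mu> d \<and>
        1 \<le> l \<and> ereal l < 2 * qdiam \<mu> d / ereal r \<longrightarrow>
        inverse C * l powr \<alpha> * V x r \<le> V x (l * r)"
    using assms unfolding cond_R_def V_def by auto
  have "(d y z / r) powr \<alpha> * V x r \<le> C * V x (d y z)"
    if *: "x \<in> space \<mu>" "y \<in> space \<mu>" "z \<in> space \<mu>" "0 < r" "r \<le> d y z" for x y z r
  proof -
    \<comment> \<open>One inequality yields both range conditions: \<open>u = 1\<close> bounds the
      radius, \<open>u = r\<close> bounds the dilation factor.\<close>
    have less: "ereal s < 2 * qdiam \<mu> d / ereal u" if "0 < s" "0 < u" "s * u \<le> d y z" for s u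
    proof -
      define p where "p = s * u"
      have p: "0 < p" "ereal p \<le> qdiam \<mu> d"
        using dist_le_qdiam[OF *(2,3)] that
        by (auto simp: p_def intro: order_trans[of _ "ereal (d y z)"])
      then have "ereal p < 2 * qdiam \<mu> d"
        by (cases "qdiam \<mu> d") auto
      then show ?thesis
        using that(2) by (cases "qdiam \<mu> d") (auto simp: p_def pos_less_divide_eq)
    qed
    have "ereal r < 2 * qdiam \<mu> d" "ereal (d y z / r) < 2 * qdiam \<mu> d / ereal r"
      using less[of r 1] less[of "d y z / r" r] * by (auto simp: one_ereal_def[symmetric])
    with C(2) * have "inverse C * (d y z / r) powr \<alpha> * V x r \<le> V x (d y z / r * r)"
      by (intro C(2)[rule_format]) auto
    then show ?thesis
      using C(1) *(4) by (simp add: field_simps)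
  qed
  with C(1) show ?thesis by blast
qed

text \<open>If \<open>r > d x y\<close>, the two balls are comparable. Otherwise put
  \<open>l = d x y / r\<close>: enlarging the ball around \<open>y\<close> by \<open>l\<close> gains
  \<open>l powr \<alpha>\<close> by reverse doubling, the enlarged ball lies in a comparable one
  around \<open>x\<close>, and shrinking that one back to radius \<open>r\<close> costs
  \<open>l powr n\<close>. The net loss is \<open>l powr (n - \<alpha>)\<close>.\<close>

lemma cond_E_diff:
  assumes D: "cond_D \<mu> d n" and R: "cond_R \<mu> d \<alpha>" and "0 < n" "0 \<le> \<alpha>" "\<alpha> \<le> n"
  shows "cond_E \<mu> d (n - \<alpha>)"
proof -
  obtain Cd where Cd: "Cd > 0" "\<forall>x\<in>space \<mu>. \<forall>r>0. \<forall>l\<ge>1. V x (l * r) \<le> Cd * l powr n * V x r"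
    using D unfolding cond_D_iff by blast
  obtain Cr where Cr: "Cr \<ge> 1"
    "\<forall>x\<in>space \<mu>. \<forall>y\<in>space \<mu>. \<forall>z\<in>space \<mu>. \<forall>r>0. r \<le> d y z \<longrightarrow>
      (d y z / r) powr \<alpha> * V x r \<le> Cr * V x (d y z)"
    using cond_R_dist[OF R] by blast
  obtain Cb where Cb: "Cb \<ge> 1"
    "\<forall>x\<in>space \<mu>. \<forall>y\<in>space \<mu>. \<forall>r. d x y \<le> r \<longrightarrow> B x r \<subseteq> B y (Cb * r)"
    using ball_subset_ball by blast
  have scale: "V x (Cb * l * r) \<le> Cd * Cb powr n * l powr n * V x r"
    if "x \<in> space \<mu>" "0 < r" "1 \<le> l" for x r l
  proof -
    have "1 \<le> Cb * l"
      using that Cb(1) mult_mono[of 1 Cb 1 l] by auto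
    with Cd(2) that Cb(1) have "V x (Cb * l * r) \<le> Cd * (Cb * l) powr n * V x r"
      by blast
    then show ?thesis
      using that Cb(1) by (simp add: powr_mult mult.assoc)
  qed
  have "V y r \<le> Cr * Cd * Cb powr n * (1 + d x y / r) powr (n - \<alpha>) * V x r"
    if x: "x \<in> space \<mu>" and y: "y \<in> space \<mu>" and r: "0 < r" for x y r
  proof (cases "r \<le> d x y")
    case False
    then have "V y r \<le> V x (Cb * 1 * r)"
      using x y r Cb by (intro V_mono_subset) (auto simp: dist_sym)
    also have "\<dots> \<le> Cd * Cb powr n * 1 powr n * V x r"
      using scale[OF x r, of 1] by simp
    also have "\<dots> \<le> Cr * Cd * Cb powr n * (1 + d x y / r) powr (n - \<alpha>) * V x r"
      using Cr(1) Cd(1) Cb(1) assms(5) r V_pos[OF x r] dist_nonneg[OF x y]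
      by (intro mult_mono) (auto simp: ge_one_powr_ge_zero intro!: mult_ge1_I)
    finally show ?thesis .
  next
    case True
    define l where "l = d x y / r"
    have l: "1 \<le> l" "d x y = l * r"
      using True r by (auto simp: l_def)
    have "l powr \<alpha> * V y r \<le> Cr * V y (l * r)"
      using Cr(2)[rule_format, of y x y r] x y r True l by simp
    also have "V y (l * r) \<le> V x (Cb * l * r)"
      using x y r l Cb by (intro V_mono_subset) (auto simp: dist_sym mult.assoc)
    also have "\<dots> \<le> Cd * Cb powr n * l powr n * V x r"
      using scale x r l by auto
    finally have "l powr \<alpha> * V y r \<le> Cr * (Cd * Cb powr n * l powr n * V x r)"
      using Cr(1) by simp
    then have "V y r \<le> Cr * (Cd * Cb powr n * l powr n * V x r) / l powr \<alpha>"
      using l by (simp add: field_simps)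
    also have "\<dots> = Cr * Cd * Cb powr n * l powr (n - \<alpha>) * V x r"
      by (simp add: powr_diff)
    also have "\<dots> \<le> Cr * Cd * Cb powr n * (1 + l) powr (n - \<alpha>) * V x r"
      using Cr(1) Cd(1) V_pos[OF x r] assms(5) l
      by (intro mult_right_mono mult_left_mono powr_mono2) auto
    finally show ?thesis by (simp add: l_def)
  qed
  then show ?thesis
    unfolding cond_E_def V_def by blast
qed

text \<open>This is what makes the range of \<beta> in the growth class nonempty as soon as
  \<open>M\<close> exceeds the critical index.\<close>

lemma deg_N_le: "deg_N \<mu> d \<le> deg_n \<mu> d - deg_\<alpha> \<mu> d"
proof (rule field_le_epsilon)
  fix e :: real assume "0 < e"
  then have e: "deg_n \<mu> d < deg_n \<mu> d + e / 2" "deg_\<alpha> \<mu> d - e / 2 < deg_\<alpha> \<mu> d"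
    by auto
  obtain n where n: "0 < n" "cond_D \<mu> d n" "n < deg_n \<mu> d + e / 2"
    by (rule deg_n_approx[OF e(1)])
  obtain \<alpha> where \<alpha>: "0 \<le> \<alpha>" "\<alpha> \<le> n" "cond_R \<mu> d \<alpha>" "deg_\<alpha> \<mu> d - e / 2 < \<alpha>"
    using deg_\<alpha>_approx[OF e(2)] n(1,2) by metis
  have "deg_N \<mu> d \<le> n - \<alpha>"
    unfolding deg_N_def using cond_E_diff[OF n(2) \<alpha>(3) n(1) \<alpha>(1,2)] \<alpha>
    by (intro cInf_lower bdd_belowI[of _ 0]) auto
  with n \<alpha> show "deg_N \<mu> d \<le> deg_n \<mu> d - deg_\<alpha> \<mu> d + e"
    by linarith
qed

end

section \<open>Weights and indices of a growth function\<close>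

lemma finite_ennrealE:
  assumes "x < (\<infinity>::ennreal)"
  obtains r where "0 \<le> r" "x = ennreal r"
  using assms by (cases x) auto

lemma nn_integral_set_pos:
  assumes "A \<in> sets M" "0 < emeasure M A" "f \<in> borel_measurable M"
    and "\<And>x. x \<in> A \<Longrightarrow> 0 < f x"
  shows "0 < (\<integral>\<^sup>+x\<in>A. f x \<partial>M)"
proof (rule ccontr)
  assume "\<not> ?thesis"
  then have "emeasure M {x\<in>space M. f x * indicator A x \<noteq> 0} = 0"
    using assms by (subst nn_integral_0_iff[symmetric]) auto
  also have "{x\<in>space M. f x * indicator A x \<noteq> 0} = A"
    using assms(1,4) sets.sets_into_space by (fastforce simp: indicator_def)
  finally show False
    using assms(2) by simp
qed

text \<open>Integrated over a ball for the right \<open>\<kappa>\<close>, this replaces Hoelder's inequality.\<close>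

lemma one_le_split:
  fixes w \<kappa> q :: real
  assumes "0 < w" "0 < \<kappa>" "1 < q"
  shows "1 \<le> w / \<kappa> + \<kappa> powr (1 / (q - 1)) * w powr (- 1 / (q - 1))"
proof (cases "\<kappa> \<le> w")
  case True
  then show ?thesis
    using assms by (simp add: add_increasing2)
next
  case False
  then have "1 \<le> (\<kappa> / w) powr (1 / (q - 1))"
    using assms by (intro ge_one_powr_ge_zero) auto
  also have "\<dots> = \<kappa> powr (1 / (q - 1)) * w powr (- 1 / (q - 1))"
    using assms by (simp add: powr_divide powr_minus_divide)
  finally show ?thesis
    using assms by (simp add: add_increasing)
qed

section \<open>Lower type and the indices of a growth function\<close>

locale growth_space = homogeneous_space +
  fixes \<phi> :: "'a \<Rightarrow> real \<Rightarrow> real"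
  assumes growth: "growth_function \<mu> d \<phi>"
begin

lemma \<phi>_orlicz: "x \<in> space \<mu> \<Longrightarrow> orlicz (\<phi> x)"
  using growth by (simp add: growth_function_def)

lemma \<phi>_0: "x \<in> space \<mu> \<Longrightarrow> \<phi> x 0 = 0"
  and \<phi>_pos: "x \<in> space \<mu> \<Longrightarrow> 0 < t \<Longrightarrow> 0 < \<phi> x t"
  using \<phi>_orlicz[of x] by (simp_all add: orlicz_def)

lemma \<phi>_measurable[measurable]: "0 \<le> t \<Longrightarrow> (\<lambda>x. \<phi> x t) \<in> borel_measurable \<mu>"
  using growth by (simp add: growth_function_def)

text \<open>The case \<open>t = 0\<close> is covered by \<open>\<phi> x 0 = 0\<close>. A constant of
  at least 2 makes the scaling factors built from it later lie strictly on one side of 1.\<close>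

lemma lower_type_iff:
  "lower_type \<mu> \<phi> p \<longleftrightarrow>
     (\<exists>C\<ge>2. \<forall>x\<in>space \<mu>. \<forall>t>0. \<forall>s\<in>{0<..<1}. \<phi> x (s * t) \<le> C * s powr p * \<phi> x t)"
proof
  assume "lower_type \<mu> \<phi> p"
  then obtain C where C: "\<forall>x\<in>space \<mu>. \<forall>t\<ge>0. \<forall>s\<in>{0<..<1}. \<phi> x (s * t) \<le> C * s powr p * \<phi> x t"
    unfolding lower_type_def by blast
  have "\<phi> x (s * t) \<le> max C 2 * s powr p * \<phi> x t" if "x \<in> space \<mu>" "0 < t" "s \<in> {0<..<1}" for x t s
  proof -
    have "\<phi> x (s * t) \<le> C * s powr p * \<phi> x t"
      using C that by auto
    also have "\<dots> \<le> max C 2 * s powr p * \<phi> x t"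
      using \<phi>_pos[OF that(1,2)] by (intro mult_right_mono) auto
    finally show ?thesis .
  qed
  then show "\<exists>C\<ge>2. \<forall>x\<in>space \<mu>. \<forall>t>0. \<forall>s\<in>{0<..<1}. \<phi> x (s * t) \<le> C * s powr p * \<phi> x t"
    by (intro exI[of _ "max C 2"]) auto
next
  assume "\<exists>C\<ge>2. \<forall>x\<in>space \<mu>. \<forall>t>0. \<forall>s\<in>{0<..<1}. \<phi> x (s * t) \<le> C * s powr p * \<phi> x t"
  then obtain C where C: "\<forall>x\<in>space \<mu>. \<forall>t>0. \<forall>s\<in>{0<..<1}. \<phi> x (s * t) \<le> C * s powr p * \<phi> x t"
    by blast
  have "\<phi> x (s * t) \<le> C * s powr p * \<phi> x t" if "x \<in> space \<mu>" "0 \<le> t" "s \<in> {0<..<1}" for x t s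
    using C that by (cases "t = 0") (auto simp: \<phi>_0)
  then show "lower_type \<mu> \<phi> p"
    unfolding lower_type_def by blast
qed

text \<open>Going down from 1 to \<open>s\<close> by lower type \<open>p\<close> and back up by
  upper type 1 gives \<open>\<phi> x 1 \<le> D * C * s powr (p - 1) * \<phi> x 1\<close>, which
  fails for small \<open>s\<close> if \<open>p > 1\<close>. Thus the supremum defining
  \<open>lower_index\<close> is over a bounded set.\<close>

lemma lower_type_le_1:
  assumes "lower_type \<mu> \<phi> p"
  shows "p \<le> 1"
proof (rule ccontr)
  assume p: "\<not> p \<le> 1"
  obtain x where x: "x \<in> space \<mu>"
    using space_nonempty by blast
  obtain C where C: "C \<ge> 2" "\<forall>x\<in>space \<mu>. \<forall>t>0. \<forall>s\<in>{0<..<1}. \<phi> x (s * t) \<le> C * s powr p * \<phi> x t"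
    using assms unfolding lower_type_iff by blast
  obtain D where D: "\<forall>t\<ge>0. \<forall>s\<ge>1. \<phi> x (s * t) \<le> D * s powr 1 * \<phi> x t"
    using growth x unfolding growth_function_def upper_type_def by blast
  have "1 * \<phi> x 1 \<le> D * \<phi> x 1"
    using D[rule_format, of 1 1] by simp
  then have D1: "D \<ge> 1"
    using \<phi>_pos[OF x, of 1] by (simp add: mult_le_cancel_right)
  \<comment> \<open>Solves \<open>D * C * s powr (p - 1) = 1 / 2\<close>, which turns the estimate
    into \<open>\<phi> x 1 \<le> \<phi> x 1 / 2\<close>.\<close>
  define s where "s = (2 * D * C) powr (- 1 / (p - 1))"
  have "1 < 2 * D * C"
    using D1 C(1) mult_mono[of 1 D 2 C] by auto
  then have s: "0 < s" "s < 1"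
    using p by (auto simp: s_def powr_less_one)
  have "s powr (p - 1) = (2 * D * C) powr (- 1)"
    using p by (simp add: s_def powr_powr divide_simps)
  then have sp: "D * C * s powr (p - 1) = 1 / 2"
    using D1 C(1) by (simp add: powr_minus field_simps)
  have "\<phi> x ((1 / s) * s) \<le> D * (1 / s) powr 1 * \<phi> x s"
    using D s by (intro D[rule_format]) auto
  then have "\<phi> x 1 \<le> (D / s) * \<phi> x s"
    using s by simp
  also have "\<dots> \<le> (D / s) * (C * s powr p * \<phi> x 1)"
    using C(2)[rule_format, of x 1 s] x s D1 by (intro mult_left_mono) auto
  also have "\<dots> = (D * C * s powr (p - 1)) * \<phi> x 1"
    using s by (simp add: powr_diff)
  finally show False
    using \<phi>_pos[OF x, of 1] unfolding sp by simp
qed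

lemma lower_index_bounds: "0 < lower_index \<mu> \<phi>" "lower_index \<mu> \<phi> \<le> 1"
proof -
  obtain p where p: "0 < p" "lower_type \<mu> \<phi> p"
    using growth unfolding growth_function_def by auto
  then have "p \<le> lower_index \<mu> \<phi>"
    unfolding lower_index_def using lower_type_le_1
    by (intro cSup_upper bdd_aboveI[of _ 1]) auto
  with p show "0 < lower_index \<mu> \<phi>"
    by simp
  show "lower_index \<mu> \<phi> \<le> 1"
    unfolding lower_index_def using p lower_type_le_1 by (intro cSup_least) auto
qed

lemma lower_index_approx:
  assumes "c < lower_index \<mu> \<phi>"
  obtains p where "0 < p" "lower_type \<mu> \<phi> p" "c < p"
proof -
  obtain q where "0 < q" "lower_type \<mu> \<phi> q"
    using growth unfolding growth_function_def by auto
  then have "{p. 0 < p \<and> lower_type \<mu> \<phi> p} \<noteq> {}"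
    by auto
  then obtain p where "p \<in> {p. 0 < p \<and> lower_type \<mu> \<phi> p}" "c < p"
    using assms less_cSupE unfolding lower_index_def by metis
  then show thesis
    using that[of p] by simp
qed

lemma weight_index_ge_1: "1 \<le> weight_index \<mu> d \<phi>"
  using growth unfolding weight_index_def growth_function_def
  by (intro cInf_greatest) auto

lemma weight_index_approx:
  assumes "weight_index \<mu> d \<phi> < c"
  obtains q where "1 \<le> q" "muckenhoupt \<mu> d q \<phi>" "q < c"
proof -
  have "{p. 1 \<le> p \<and> muckenhoupt \<mu> d p \<phi>} \<noteq> {}"
    using growth unfolding growth_function_def by auto
  then obtain q where "q \<in> {p. 1 \<le> p \<and> muckenhoupt \<mu> d p \<phi>}" "q < c"
    using assms cInf_lessD unfolding weight_index_def by metis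
  then show thesis
    using that[of q] by simp
qed

section \<open>Muckenhoupt weights and doubling of the weighted measures\<close>

definition W :: "real \<Rightarrow> 'a \<Rightarrow> real \<Rightarrow> ennreal" where
  "W t x r = (\<integral>\<^sup>+y\<in>B x r. ennreal (\<phi> y t) \<partial>\<mu>)"

lemma W_pos: "x \<in> space \<mu> \<Longrightarrow> 0 < r \<Longrightarrow> 0 < t \<Longrightarrow> 0 < W t x r"
  unfolding W_def
  by (intro nn_integral_set_pos sets_ball emeasure_ball_pos)
    (auto intro!: \<phi>_pos dest: ball_in_space)

text \<open>The second factor of the Muckenhoupt product, with the cases \<open>q = 1\<close> and
  \<open>q > 1\<close> merged so that both share the passage to real numbers.\<close>

definition dual_weight :: "real \<Rightarrow> real \<Rightarrow> 'a \<Rightarrow> real \<Rightarrow> ennreal" where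
  "dual_weight q t x r =
     (if q = 1 then esssup (restrict_space \<mu> (B x r)) (\<lambda>y. ennreal (inverse (\<phi> y t)))
      else ennreal_powr (nn_average \<mu> (B x r) (\<lambda>y. ennreal (\<phi> y t powr (- 1 / (q - 1))))) (q - 1))"

lemma muckenhoupt_bound:
  assumes "muckenhoupt \<mu> d q \<phi>"
  shows "\<exists>K>0. \<forall>x\<in>space \<mu>. \<forall>r>0. \<forall>t>0.
           W t x r / ennreal (V x r) * dual_weight q t x r \<le> ennreal K"
proof -
  let ?S = "SUP t\<in>{0<..}. SUP x\<in>space \<mu>. SUP r\<in>{0<..}.
    nn_average \<mu> (B x r) (\<lambda>y. ennreal (\<phi> y t)) * dual_weight q t x r"
  have "?S < \<infinity>"
    using assms unfolding muckenhoupt_def dual_weight_def .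
  then obtain K where K: "0 \<le> K" "?S = ennreal K"
    by (rule finite_ennrealE)
  have "W t x r / ennreal (V x r) * dual_weight q t x r \<le> ennreal (K + 1)"
    if "x \<in> space \<mu>" "0 < r" "0 < t" for x r t
  proof -
    have "nn_average \<mu> (B x r) (\<lambda>y. ennreal (\<phi> y t)) * dual_weight q t x r \<le> ?S"
      using that by - (rule SUP_upper2[of t], simp, rule SUP_upper2[of x], simp, rule SUP_upper2[of r], simp_all)
    then show ?thesis
      using K(2) that order_trans[OF _ ennreal_leI[of K "K + 1"]]
      by (simp add: nn_average_def W_def emeasure_ball)
  qed
  with K(1) show ?thesis
    by (intro exI[of _ "K + 1"]) auto
qed

text \<open>A product of two nonzero extended numbers can be finite only if both factors are. The
  positivity of the dual factor excludes the convention that zero times infinity is zero. Finiteness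
  of the weighted measures of balls originates here.\<close>

lemma W_real:
  assumes x: "x \<in> space \<mu>" "0 < r" "0 < t"
    and "W t x r / ennreal (V x r) * dual_weight q t x r \<le> ennreal K" "0 < dual_weight q t x r" "0 < K"
  obtains w \<sigma> where "0 < w" "0 < \<sigma>" "W t x r = ennreal w" "dual_weight q t x r = ennreal \<sigma>"
    "w * \<sigma> \<le> K * V x r"
proof -
  have "W t x r \<noteq> \<infinity>" "dual_weight q t x r \<noteq> \<infinity>"
    using assms(4,5) W_pos[OF x] V_pos[OF x(1,2)]
    by (auto simp: ennreal_top_divide ennreal_top_mult ennreal_mult_top top_unique split: if_splits)
  then obtain w \<sigma> where w: "0 \<le> w" "0 \<le> \<sigma>" "W t x r = ennreal w" "dual_weight q t x r = ennreal \<sigma>"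
    by (metis ennreal_cases infinity_ennreal_def)
  moreover from w have "0 < w" "0 < \<sigma>"
    using W_pos[OF x] assms(5) by auto
  moreover have "w / V x r * \<sigma> \<le> K"
    using assms(4,6) w V_pos[OF x(1,2)] by (simp add: divide_ennreal flip: ennreal_mult)
  then have "w * \<sigma> \<le> K * V x r"
    using V_pos[OF x(1,2)] by (simp add: field_simps)
  ultimately show thesis
    using that[of w \<sigma>] by blast
qed

lemma W_mono: "B x r \<subseteq> B y s \<Longrightarrow> W t x r \<le> W t y s"
  unfolding W_def by (intro nn_integral_mono) (auto simp: indicator_def)

text \<open>With \<open>S\<close> the essential supremum of \<open>1 / \<phi>\<close> over the large
  ball, \<open>1 \<le> S * \<phi>\<close> almost everywhere there, so the measure of the small ball
  is at most \<open>S\<close> times its weighted measure. The condition bounds \<open>S\<close>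
  times the weighted measure of the large ball; multiplying the two eliminates
  \<open>S\<close>.\<close>

lemma A1_doubling:
  assumes "muckenhoupt \<mu> d 1 \<phi>"
  shows "\<exists>C>0. \<forall>x\<in>space \<mu>. \<forall>r>0. \<forall>y\<in>space \<mu>. \<forall>s>0. \<forall>t>0. B x r \<subseteq> B y s \<longrightarrow>
    W t y s < \<infinity> \<and> W t y s \<le> ennreal (C * (V y s / V x r) powr 1) * W t x r"
proof -
  obtain K where K: "K > 0" "\<forall>x\<in>space \<mu>. \<forall>r>0. \<forall>t>0.
           W t x r / ennreal (V x r) * dual_weight 1 t x r \<le> ennreal K"
    using muckenhoupt_bound[OF assms] by blast
  have "W t y s < \<infinity> \<and> W t y s \<le> ennreal (K * (V y s / V x r) powr 1) * W t x r"
    if x: "x \<in> space \<mu>" "0 < r" and y: "y \<in> space \<mu>" "0 < s" and t: "0 < t" and sub: "B x r \<subseteq> B y s"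
    for x r y s t
  proof -
    define S where "S = dual_weight 1 t y s"
    have sets [measurable]: "B y s \<in> sets \<mu>" "B x r \<in> sets \<mu>"
      using x y by (auto intro: sets_ball)
    have "AE z in restrict_space \<mu> (B y s). ennreal (inverse (\<phi> z t)) \<le> S"
      unfolding S_def dual_weight_def by (simp add: esssup_AE)
    then have AE: "AE z in \<mu>. z \<in> B y s \<longrightarrow> ennreal (inverse (\<phi> z t)) \<le> S"
      by (subst (asm) AE_restrict_space_iff) (use sets in auto)
    have "emeasure \<mu> (B x r) = (\<integral>\<^sup>+z\<in>B x r. 1 \<partial>\<mu>)"
      by simp
    also have "\<dots> \<le> (\<integral>\<^sup>+z. S * (ennreal (\<phi> z t) * indicator (B x r) z) \<partial>\<mu>)"
    proof (rule nn_integral_mono_AE, use AE in eventually_elim)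
      case (elim z)
      show ?case
      proof (cases "z \<in> B x r")
        case True
        then have "1 = ennreal (inverse (\<phi> z t)) * ennreal (\<phi> z t)"
          using \<phi>_pos[OF ball_in_space[OF True] t] by (simp flip: ennreal_mult)
        also have "\<dots> \<le> S * ennreal (\<phi> z t)"
          using elim True sub by (intro mult_right_mono) auto
        finally show ?thesis
          using True by simp
      qed simp
    qed
    also have "\<dots> = S * W t x r"
      using t unfolding W_def by (subst nn_integral_cmult) auto
    finally have 1: "ennreal (V x r) \<le> S * W t x r"
      using x by (simp add: emeasure_ball)
    then have "0 < S"
      using V_pos[OF x] by (cases "S = 0") (auto simp: zero_less_iff_neq_zero)
    then obtain w' \<sigma> where w': "0 < w'" "0 < \<sigma>" "W t y s = ennreal w'" "S = ennreal \<sigma>"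
      "w' * \<sigma> \<le> K * V y s"
      using W_real[OF y t _ _ K(1), of 1] K(2) y t unfolding S_def by metis
    have "W t x r < \<infinity>"
      using W_mono[OF sub, of t] w'(3) by (simp add: le_less_trans)
    then obtain w where w: "0 \<le> w" "W t x r = ennreal w"
      by (rule finite_ennrealE)
    have "V x r \<le> \<sigma> * w"
      using 1 w w' by (simp add: ennreal_mult'[symmetric])
    then have "w' * V x r \<le> w' * (\<sigma> * w)"
      using w' by (intro mult_left_mono) auto
    also have "\<dots> = (w' * \<sigma>) * w"
      by simp
    also have "\<dots> \<le> K * V y s * w"
      using w'(5) w(1) by (intro mult_right_mono) auto
    finally have "w' \<le> K * (V y s / V x r) powr 1 * w"
      using V_pos[OF x] V_pos[OF y] by (simp add: field_simps)
    then show ?thesis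
      using w w' K(1) by (simp add: ennreal_mult'[symmetric])
  qed
  with K(1) show ?thesis by blast
qed

text \<open>Integrating \<open>one_le_split\<close> over the small ball bounds its measure by
  \<open>W t x r / \<kappa>\<close> plus \<open>\<kappa> powr (1 / (q - 1)) * S\<close>, where
  \<open>S\<close> is the dual integral over the large ball. A suitable \<kappa> absorbs the second
  term, giving a lower bound for \<open>W t x r\<close>, while the condition gives an upper bound
  for \<open>W t y s\<close>.\<close>

lemma Aq_doubling:
  assumes q: "1 < q" and "muckenhoupt \<mu> d q \<phi>"
  shows "\<exists>C>0. \<forall>x\<in>space \<mu>. \<forall>r>0. \<forall>y\<in>space \<mu>. \<forall>s>0. \<forall>t>0. B x r \<subseteq> B y s \<longrightarrow>
    W t y s < \<infinity> \<and> W t y s \<le> ennreal (C * (V y s / V x r) powr q) * W t x r"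
proof -
  obtain K where K: "K > 0" "\<forall>x\<in>space \<mu>. \<forall>r>0. \<forall>t>0.
           W t x r / ennreal (V x r) * dual_weight q t x r \<le> ennreal K"
    using muckenhoupt_bound[OF assms(2)] by blast
  have "W t y s < \<infinity> \<and> W t y s \<le> ennreal (K * 2 powr q * (V y s / V x r) powr q) * W t x r"
    if x: "x \<in> space \<mu>" "0 < r" and y: "y \<in> space \<mu>" "0 < s" and t: "0 < t" and sub: "B x r \<subseteq> B y s"
    for x r y s t
  proof -
    define S where "S = (\<integral>\<^sup>+z\<in>B y s. ennreal (\<phi> z t powr (- 1 / (q - 1))) \<partial>\<mu>)"
    define b b' where "b = V x r" and "b' = V y s"
    have b: "0 < b" "0 < b'"
      using V_pos x y by (auto simp: b_def b'_def)
    have sets [measurable]: "B y s \<in> sets \<mu>" "B x r \<in> sets \<mu>"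
      using x y by (auto intro: sets_ball)
    have "0 < S"
      unfolding S_def using y t
      by (intro nn_integral_set_pos sets emeasure_ball_pos)
        (auto dest!: ball_in_space \<phi>_pos[of _ t])
    have dual: "dual_weight q t y s = ennreal_powr (S / ennreal b') (q - 1)"
      using q y by (simp add: dual_weight_def nn_average_def S_def b'_def emeasure_ball)
    have "0 < dual_weight q t y s"
      using \<open>0 < S\<close> b unfolding dual ennreal_powr_def
      by (auto simp: enn2real_eq_0_iff ennreal_zero_less_divide intro!: order.not_eq_order_implies_strict)
    then obtain w' \<sigma> where w': "0 < w'" "0 < \<sigma>" "W t y s = ennreal w'" "dual_weight q t y s = ennreal \<sigma>"
      "w' * \<sigma> \<le> K * b'"
      using W_real[OF y t _ _ K(1), of q] K(2) y t unfolding b'_def by metis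
    have "S \<noteq> \<infinity>"
      using w'(4) b unfolding dual ennreal_powr_def by (auto simp: ennreal_top_divide)
    with \<open>0 < S\<close> obtain Sg where Sg: "0 < Sg" "S = ennreal Sg"
      by (metis ennreal_cases infinity_ennreal_def ennreal_less_zero_iff)
    have \<sigma>: "\<sigma> = (Sg / b') powr (q - 1)"
      using w'(2,4) Sg b unfolding dual ennreal_powr_def by (simp add: divide_ennreal)
    have "W t x r < \<infinity>"
      using W_mono[OF sub, of t] w'(3) by (simp add: le_less_trans)
    then obtain w where w: "0 \<le> w" "W t x r = ennreal w"
      by (rule finite_ennrealE)
    \<comment> \<open>Chosen so that the dual term equals \<open>b / 2\<close>, half of the
      left-hand side.\<close>
    define \<kappa> where "\<kappa> = (b / (2 * Sg)) powr (q - 1)"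
    have \<kappa>: "0 < \<kappa>" "\<kappa> powr (1 / (q - 1)) = b / (2 * Sg)"
      using b Sg q by (simp_all add: \<kappa>_def powr_powr)
    have "ennreal b = (\<integral>\<^sup>+z\<in>B x r. 1 \<partial>\<mu>)"
      using x by (simp add: b_def emeasure_ball)
    also have "\<dots> \<le> (\<integral>\<^sup>+z. ennreal (1 / \<kappa>) * (ennreal (\<phi> z t) * indicator (B x r) z) +
        ennreal (b / (2 * Sg)) * (ennreal (\<phi> z t powr (- 1 / (q - 1))) * indicator (B y s) z) \<partial>\<mu>)"
    proof (rule nn_integral_mono)
      fix z assume "z \<in> space \<mu>"
      then have "ennreal 1 \<le> ennreal (1 / \<kappa> * \<phi> z t + b / (2 * Sg) * \<phi> z t powr (- 1 / (q - 1)))"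
        using one_le_split[OF \<phi>_pos \<kappa>(1) q, of z t] t \<kappa>(2) by (intro ennreal_leI) auto
      also have "\<dots> = ennreal (1 / \<kappa>) * ennreal (\<phi> z t) +
         ennreal (b / (2 * Sg)) * ennreal (\<phi> z t powr (- 1 / (q - 1)))"
        using \<kappa>(1) b Sg \<phi>_pos[OF \<open>z \<in> space \<mu>\<close> t]
        by (simp add: ennreal_mult'[symmetric])
      finally show "1 * indicator (B x r) z \<le> ennreal (1 / \<kappa>) * (ennreal (\<phi> z t) * indicator (B x r) z) +
        ennreal (b / (2 * Sg)) * (ennreal (\<phi> z t powr (- 1 / (q - 1))) * indicator (B y s) z)"
        using sub by (auto simp: indicator_def)
    qed
    also have "\<dots> = ennreal (1 / \<kappa>) * W t x r + ennreal (b / (2 * Sg)) * S"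
      using t unfolding W_def S_def by (simp add: nn_integral_add nn_integral_cmult)
    also have "\<dots> = ennreal (1 / \<kappa> * w + b / (2 * Sg) * Sg)"
      using w Sg \<kappa>(1) b by (simp add: ennreal_mult'[symmetric])
    finally have "b \<le> 1 / \<kappa> * w + b / (2 * Sg) * Sg"
      using w Sg \<kappa>(1) b by (subst (asm) ennreal_le_iff) auto
    then have w_ge: "b * \<kappa> / 2 \<le> w"
      using Sg \<kappa>(1) by (simp add: field_simps)
    have "K * b' = K * b' / \<sigma> * \<sigma>"
      using w'(2) by simp
    with w'(5) have "w' \<le> K * b' / \<sigma>"
      using w'(2) by (simp add: field_simps)
    \<comment> \<open>The dual integral \<open>Sg\<close> cancels between \<sigma> and \<kappa>,
      leaving only the ratio of the measures of the two balls.\<close>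
    also have "\<dots> = K * 2 powr q * (b' / b) powr q * (b * \<kappa> / 2)"
      using b Sg by (simp add: \<sigma> \<kappa>_def powr_divide powr_diff powr_mult)
    also have "\<dots> \<le> K * 2 powr q * (b' / b) powr q * w"
      using w_ge K(1) by (intro mult_left_mono) auto
    finally show ?thesis
      using w w' K(1) by (simp add: b_def b'_def ennreal_mult'[symmetric])
  qed
  with K(1) show ?thesis
    by (intro exI[of _ "K * 2 powr q"]) auto
qed

lemma weight_doubling:
  assumes "1 \<le> q" "muckenhoupt \<mu> d q \<phi>"
  shows "\<exists>C>0. \<forall>x\<in>space \<mu>. \<forall>r>0. \<forall>y\<in>space \<mu>. \<forall>s>0. \<forall>t>0. B x r \<subseteq> B y s \<longrightarrow>
    W t y s < \<infinity> \<and> W t y s \<le> ennreal (C * (V y s / V x r) powr q) * W t x r"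
  using A1_doubling Aq_doubling[of q] assms by (cases "q = 1") auto

end

section \<open>Norms of characteristic functions of balls\<close>

context growth_space
begin

abbreviation lux :: "'a \<Rightarrow> real \<Rightarrow> ennreal" where
  "lux x r \<equiv> luxemburg_norm \<mu> \<phi> (indicator (B x r))"

definition L :: "'a \<Rightarrow> real \<Rightarrow> real" where
  "L x r = enn2real (lux x r)"

text \<open>Since \<open>\<phi> y 0 = 0\<close>, the integrand vanishes off the ball. The norm is
  thereby governed by how \<open>W t x r\<close> depends on \<open>t\<close>.\<close>

lemma lux_eq: "lux x r = Inf {ennreal l | l. 0 < l \<and> W (1 / l) x r \<le> 1}"
proof -
  have "(\<integral>\<^sup>+y. ennreal (\<phi> y (\<bar>indicator (B x r) y\<bar> / l)) \<partial>\<mu>) = W (1 / l) x r" for l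
    unfolding W_def by (intro nn_integral_cong) (simp add: indicator_def \<phi>_0)
  then show ?thesis
    unfolding luxemburg_norm_def by simp
qed

lemma lux_le: "0 < l \<Longrightarrow> W (1 / l) x r \<le> 1 \<Longrightarrow> lux x r \<le> ennreal l"
  unfolding lux_eq by (intro Inf_lower) auto

lemma lux_ge: "(\<And>l. 0 < l \<Longrightarrow> W (1 / l) x r \<le> 1 \<Longrightarrow> c \<le> ennreal l) \<Longrightarrow> c \<le> lux x r"
  unfolding lux_eq by (intro Inf_greatest) auto

lemma W_lower_type:
  assumes "lower_type \<mu> \<phi> p"
  shows "\<exists>C\<ge>2. \<forall>x\<in>space \<mu>. \<forall>r>0. \<forall>t>0. \<forall>s\<in>{0<..<1}. W (s * t) x r \<le> ennreal (C * s powr p) * W t x r"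
proof -
  obtain C where C: "C \<ge> 2" "\<forall>x\<in>space \<mu>. \<forall>t>0. \<forall>s\<in>{0<..<1}. \<phi> x (s * t) \<le> C * s powr p * \<phi> x t"
    using assms unfolding lower_type_iff by blast
  have "W (s * t) x r \<le> ennreal (C * s powr p) * W t x r"
    if "x \<in> space \<mu>" "0 < r" "0 < t" "s \<in> {0<..<1}" for x r t s
  proof -
    have [measurable]: "B x r \<in> sets \<mu>"
      using that by (intro sets_ball)
    have "ennreal (\<phi> y (s * t)) \<le> ennreal (C * s powr p) * ennreal (\<phi> y t)" if "y \<in> space \<mu>" for y
      using C(1) C(2)[rule_format, OF that \<open>0 < t\<close> \<open>s \<in> _\<close>]
      by (subst ennreal_mult'[symmetric]) (auto intro: ennreal_leI)
    then have "W (s * t) x r \<le> (\<integral>\<^sup>+y. ennreal (C * s powr p) * (ennreal (\<phi> y t) * indicator (B x r) y) \<partial>\<mu>)"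
      unfolding W_def by (intro nn_integral_mono) (auto simp: indicator_def)
    also have "\<dots> = ennreal (C * s powr p) * W t x r"
      using that unfolding W_def by (intro nn_integral_cmult) auto
    finally show ?thesis .
  qed
  with C(1) show ?thesis by blast
qed

lemma W_finite: "x \<in> space \<mu> \<Longrightarrow> 0 < r \<Longrightarrow> 0 < t \<Longrightarrow> W t x r < \<infinity>"
  using growth weight_doubling unfolding growth_function_def by blast

text \<open>Lower type pushes \<open>W s x r\<close> below 1 for some small \<open>s\<close>, so
  \<open>1 / s\<close> is an admissible \<open>l\<close>. Conversely an admissible
  \<open>l < 1\<close> satisfies \<open>W 1 x r \<le> C * l powr p\<close>, so the admissible values
  stay away from 0.\<close>

lemma lux_pos_finite:
  assumes x: "x \<in> space \<mu>" "0 < r"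
  shows "0 < lux x r" "lux x r < \<infinity>"
proof -
  obtain p where p: "0 < p" "lower_type \<mu> \<phi> p"
    using growth unfolding growth_function_def by auto
  obtain C where C: "C \<ge> 2" "\<forall>x\<in>space \<mu>. \<forall>r>0. \<forall>t>0. \<forall>s\<in>{0<..<1}. W (s * t) x r \<le> ennreal (C * s powr p) * W t x r"
    using W_lower_type[OF p(2)] by blast
  obtain w where "0 \<le> w" "W 1 x r = ennreal w"
    using W_finite[OF x zero_less_one] by (rule finite_ennrealE)
  then have w: "0 < w" "W 1 x r = ennreal w"
    using W_pos[OF x, of 1] by auto
  \<comment> \<open>Solves \<open>C * s powr p * max 1 w = 1\<close>; the maximum with 1 ensures
    \<open>s < 1\<close>.\<close>
  define s where "s = (C * max 1 w) powr (- 1 / p)"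
  have "1 < C * max 1 w"
    using C(1) mult_mono[of 2 C 1 "max 1 w"] by auto
  then have s: "0 < s" "s < 1"
    using p by (auto simp: s_def powr_less_one)
  have "s powr p = 1 / (C * max 1 w)"
    using p C(1) by (simp add: s_def powr_powr powr_minus_divide powr_divide)
  then have "C * s powr p * max 1 w = 1"
    using C(1) by simp
  moreover have "C * s powr p * w \<le> C * s powr p * max 1 w"
    using C(1) by (intro mult_left_mono) auto
  ultimately have sp: "C * s powr p * w \<le> 1"
    by simp
  have "W (s * 1) x r \<le> ennreal (C * s powr p) * W 1 x r"
    by (intro C(2)[rule_format] x) (use s in auto)
  also have "\<dots> \<le> 1"
    using sp w C(1) by (simp add: ennreal_mult'[symmetric])
  finally have "lux x r \<le> ennreal (1 / s)"
    using s by (intro lux_le) auto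
  then show "lux x r < \<infinity>"
    by (simp add: le_less_trans)
  define c where "c = min 1 ((w / C) powr (1 / p))"
  have "ennreal c \<le> lux x r"
  proof (intro lux_ge ennreal_leI)
    fix l :: real assume l: "0 < l" "W (1 / l) x r \<le> 1"
    show "c \<le> l"
    proof (cases "l < 1")
      case True
      have "ennreal w = W (l * (1 / l)) x r"
        using w l by simp
      also have "\<dots> \<le> ennreal (C * l powr p) * W (1 / l) x r"
        by (intro C(2)[rule_format] x) (use l True in auto)
      also have "\<dots> \<le> ennreal (C * l powr p) * 1"
        using l by (intro mult_left_mono) auto
      finally have "w / C \<le> l powr p"
        using w C(1) by (simp add: field_simps)
      then have "(w / C) powr (1 / p) \<le> (l powr p) powr (1 / p)"
        using w p C(1) by (intro powr_mono2) auto
      then show ?thesis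
        using l p by (simp add: c_def powr_powr)
    qed (simp add: c_def)
  qed
  moreover have "0 < c"
    using w C(1) by (simp add: c_def)
  ultimately show "0 < lux x r"
    by (metis ennreal_less_zero_iff less_le_trans)
qed

lemma lux_real: "x \<in> space \<mu> \<Longrightarrow> 0 < r \<Longrightarrow> lux x r = ennreal (L x r)"
  and L_pos: "x \<in> space \<mu> \<Longrightarrow> 0 < r \<Longrightarrow> 0 < L x r"
  using lux_pos_finite[of x r] by (simp_all add: L_def enn2real_positive_iff)

text \<open>If \<open>l\<close> is admissible for the small ball, then \<open>l / u\<close> is
  admissible for the large one: passing to the large ball multiplies the weighted measure by at most
  \<open>D * v powr q\<close>, and lower type gains \<open>C * u powr p\<close>, which compensates
  for the chosen \<open>u\<close>. The infimum over \<open>l\<close> gives the claim.\<close>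

lemma L_doubling:
  assumes q: "1 \<le> q" "muckenhoupt \<mu> d q \<phi>" and p: "0 < p" "lower_type \<mu> \<phi> p"
  shows "\<exists>C>0. \<forall>x\<in>space \<mu>. \<forall>r>0. \<forall>y\<in>space \<mu>. \<forall>s>0. B x r \<subseteq> B y s \<longrightarrow>
    L y s \<le> C * (V y s / V x r) powr (q / p) * L x r"
proof -
  obtain C where C: "C \<ge> 2" "\<forall>x\<in>space \<mu>. \<forall>r>0. \<forall>t>0. \<forall>s\<in>{0<..<1}. W (s * t) x r \<le> ennreal (C * s powr p) * W t x r"
    using W_lower_type[OF p(2)] by blast
  obtain D where D: "D > 0" "\<forall>x\<in>space \<mu>. \<forall>r>0. \<forall>y\<in>space \<mu>. \<forall>s>0. \<forall>t>0. B x r \<subseteq> B y s \<longrightarrow>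
    W t y s < \<infinity> \<and> W t y s \<le> ennreal (D * (V y s / V x r) powr q) * W t x r"
    using weight_doubling[OF q] by blast
  define E where "E = (C * max 1 D) powr (1 / p)"
  have E: "0 < E"
    using C(1) by (simp add: E_def)
  have "L y s \<le> E * (V y s / V x r) powr (q / p) * L x r"
    if x: "x \<in> space \<mu>" "0 < r" and y: "y \<in> space \<mu>" "0 < s" and sub: "B x r \<subseteq> B y s" for x r y s
  proof -
    define v where "v = V y s / V x r"
    have v: "1 \<le> v"
      using V_mono_subset[OF x(1) y(1) x(2) y(2) sub] V_pos[OF x] by (simp add: v_def)
    define u where "u = inverse (E * v powr (q / p))"
    have up: "u powr p = 1 / (C * max 1 D * v powr q)"
      using v C(1) E p by (simp add: u_def E_def powr_mult powr_powr inverse_eq_divide powr_divide)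
    have "1 < E"
      unfolding E_def using C(1) p mult_mono[of 2 C 1 "max 1 D"] by (intro gr_one_powr) auto
    moreover have "1 \<le> v powr (q / p)"
      using v p q by (intro ge_one_powr_ge_zero) auto
    ultimately have "1 < E * v powr (q / p)"
      using mult_less_le_imp_less[of 1 E 1 "v powr (q / p)"] by simp
    then have u: "0 < u" "u < 1"
      by (auto simp: u_def inverse_less_1_iff simp del: inverse_mult_distrib)
    have "lux y s \<le> ennreal (l / u)" if l: "0 < l" "W (1 / l) x r \<le> 1" for l
    proof (rule lux_le)
      have "W (u * (1 / l)) y s \<le> ennreal (C * u powr p) * W (1 / l) y s"
        by (intro C(2)[rule_format] y) (use u l in auto)
      also have "\<dots> \<le> ennreal (C * u powr p) * (ennreal (D * v powr q) * W (1 / l) x r)"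
        using D(2) x y sub l unfolding v_def by (intro mult_left_mono) auto
      also have "\<dots> \<le> ennreal (C * u powr p) * (ennreal (D * v powr q) * 1)"
        using l by (intro mult_left_mono) auto
      also have "\<dots> = ennreal (D / max 1 D)"
        using C(1) D(1) v by (simp add: up ennreal_mult'[symmetric])
      also have "\<dots> \<le> 1"
        by (simp add: divide_le_eq_1 less_max_iff_disj)
      finally show "W (1 / (l / u)) y s \<le> 1"
        by simp
    qed (use u l in auto)
    then have "ennreal (L y s * u) \<le> ennreal l" if "0 < l" "W (1 / l) x r \<le> 1" for l
      using u y that L_pos[OF y] by (simp add: lux_real field_simps)
    then have "ennreal (L y s * u) \<le> lux x r"
      by (rule lux_ge)
    then have "L y s * u \<le> L x r"
      using x L_pos[OF x] by (simp add: lux_real)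
    then show ?thesis
      using u E v by (simp add: u_def v_def[symmetric] field_simps)
  qed
  with E show ?thesis by blast
qed

end

section \<open>Oscillation over dyadic dilates of a ball\<close>

lemma powr_power_commute: "(2 ^ k :: real) powr a = (2 powr a) ^ k"
  by (simp add: powr_powr powr_power mult.commute flip: powr_realpow)

text \<open>Exponents for which the conditions hold with actual constants. The number
  \<open>e\<close> bounds the growth rate \<open>n * q / p - \<alpha>\<close> of norm over measure
  along dyadic dilates; its positivity lets a geometric sum of ratio \<open>2 powr e\<close> be
  controlled by its last term.\<close>

locale admissible_exponents = growth_space +
  fixes n \<alpha> q p e :: real
  assumes cond_D_n: "cond_D \<mu> d n" and n_pos: "0 < n"
    and cond_R_\<alpha>: "cond_R \<mu> d \<alpha>" and \<alpha>_nonneg: "0 \<le> \<alpha>"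
    and q: "1 \<le> q" "muckenhoupt \<mu> d q \<phi>"
    and p: "0 < p" "lower_type \<mu> \<phi> p"
    and e: "0 < e" "n * q / p - \<alpha> \<le> e"
begin

lemma V_dyadic:
  "\<exists>C>0. \<forall>x\<in>space \<mu>. \<forall>r>0. \<forall>k. V x (2 ^ k * r) \<le> C * (2 powr n) ^ k * V x r"
proof -
  obtain C where C: "C > 0" "\<forall>x\<in>space \<mu>. \<forall>r>0. \<forall>l\<ge>1. V x (l * r) \<le> C * l powr n * V x r"
    using cond_D_n unfolding cond_D_iff by blast
  have "V x (2 ^ k * r) \<le> C * (2 powr n) ^ k * V x r" if "x \<in> space \<mu>" "r > 0" for x r and k :: nat
    using C(2)[rule_format, of x r "2 ^ k"] that by (simp add: powr_power_commute)
  with C(1) show ?thesis by blast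
qed

text \<open>The growth of norm over measure, cleared of denominators. The norms grow at most like
  the power \<open>q / p\<close> of the measures, hence like \<open>2 powr (n * q / p)\<close> per
  step, while reverse doubling makes the measures grow at least like \<open>2 powr \<alpha>\<close>
  per step.\<close>

lemma L_dyadic:
  "\<exists>C\<ge>1. \<forall>x\<in>space \<mu>. \<forall>r>0. \<forall>k.
     L x (2 ^ k * r) * V x r \<le> C * (2 powr e) ^ k * L x r * V x (2 ^ k * r)"
proof -
  obtain Cd where Cd: "Cd > 0" "\<forall>x\<in>space \<mu>. \<forall>r>0. \<forall>k. V x (2 ^ k * r) \<le> Cd * (2 powr n) ^ k * V x r"
    using V_dyadic by blast
  obtain Cr where Cr: "Cr \<ge> 1"
    "\<forall>x\<in>space \<mu>. \<forall>y\<in>space \<mu>. \<forall>z\<in>space \<mu>. \<forall>r>0. r \<le> d y z \<longrightarrow>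
      (d y z / r) powr \<alpha> * V x r \<le> Cr * V x (d y z)"
    using cond_R_dist[OF cond_R_\<alpha>] by blast
  obtain Cl where Cl: "Cl > 0" "\<forall>x\<in>space \<mu>. \<forall>r>0. \<forall>y\<in>space \<mu>. \<forall>s>0. B x r \<subseteq> B y s \<longrightarrow>
    L y s \<le> Cl * (V y s / V x r) powr (q / p) * L x r"
    using L_doubling[OF q p] by blast
  define C where "C = max 1 (Cl * Cd powr (q / p) * Cr * 2 powr \<alpha>)"
  have "L x (2 ^ k * r) * V x r \<le> C * (2 powr e) ^ k * L x r * V x (2 ^ k * r)"
    if x: "x \<in> space \<mu>" "r > 0" for x r and k :: nat
  \<comment> \<open>The induction hypothesis handles steps at which the ball stays the same;
    whenever it grows, the bound is proved directly.\<close>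
  proof (induction k)
    case 0
    show ?case
      using mult_right_mono[of 1 C "L x r * V x r"] L_pos[OF x] V_pos[OF x]
      by (simp add: C_def mult.assoc)
  next
    case (Suc k)
    let ?R = "2 ^ k * r" and ?R' = "2 ^ Suc k * r"
    have R: "0 < ?R" "?R \<le> ?R'" "r \<le> ?R"
      using x by auto
    \<comment> \<open>\<open>(R\<^sub>\<alpha>)\<close> is only available below the diameter; if the ball no longer grows, neither side
      of the ratio changes.\<close>
    show ?case
    proof (cases "B x ?R' = B x ?R")
      case True
      then have eq: "L x ?R' = L x ?R" "V x ?R' = V x ?R"
        by (simp_all add: L_def V_def)
      have "C * (2 powr e) ^ k * L x r * V x ?R \<le> C * (2 powr e) ^ Suc k * L x r * V x ?R"
        using e x L_pos[OF x] V_pos[OF x(1) R(1)]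
        by (intro mult_right_mono mult_left_mono power_increasing) (auto simp: C_def ge_one_powr_ge_zero)
      with Suc show ?thesis
        unfolding eq by (rule order_trans)
    next
      case False
      \<comment> \<open>A point in the shell provides a distance between the two radii, as
        \<open>cond_R_dist\<close> requires.\<close>
      then obtain y where y: "y \<in> B x ?R'" "y \<notin> B x ?R"
        using ball_mono[OF R(2)] by blast
      then have yd: "y \<in> space \<mu>" "?R \<le> d y x" "d y x < ?R'"
        by (auto simp: qball_def)
      have rd: "r \<le> d y x" "0 < d y x"
        using yd(2) R x(2) by linarith+
      have "2 ^ k \<le> d y x / r"
        using yd(2) x(2) by (simp add: pos_le_divide_eq)
      then have "(2 powr \<alpha>) ^ k * V x r \<le> (d y x / r) powr \<alpha> * V x r"
        using \<alpha>_nonneg V_pos[OF x] powr_mono2[of \<alpha> "2 ^ k" "d y x / r"]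
        by (intro mult_right_mono) (auto simp: powr_power_commute)
      also have "\<dots> \<le> Cr * V x (d y x)"
        using Cr(2) x yd rd by auto
      also have "\<dots> \<le> Cr * V x ?R'"
        using Cr(1) x yd rd by (intro mult_left_mono V_mono) auto
      finally have lower: "(2 powr \<alpha>) ^ k * V x r \<le> Cr * V x ?R'" .
      define v v' where "v = V x r" and "v' = V x ?R'"
      have v: "0 < v" "0 < v'"
        using V_pos x R by (auto simp: v_def v'_def)
      have "v' / v \<le> Cd * (2 powr n) ^ Suc k"
        using Cd(2)[rule_format, OF x, of "Suc k"] v by (simp add: v_def v'_def field_simps)
      then have "(v' / v) powr (q / p) \<le> (Cd * (2 powr n) ^ Suc k) powr (q / p)"
        using q p v by (intro powr_mono2) auto
      also have "\<dots> = Cd powr (q / p) * (2 powr (n * q / p)) ^ Suc k"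
        using Cd(1) by (simp only: powr_mult powr_power powr_powr) (simp add: powr_powr field_simps)
      finally have "L x ?R' \<le> Cl * (Cd powr (q / p) * (2 powr (n * q / p)) ^ Suc k) * L x r"
        using Cl(1) Cl(2)[rule_format, OF x(1,2) x(1) _ ball_mono, of ?R'] R L_pos[OF x]
        by (smt (verit) mult_left_mono mult_right_mono v_def v'_def)
      moreover have "(2 powr (n * q / p)) ^ Suc k \<le> (2 powr e * 2 powr \<alpha>) ^ Suc k"
        using e(2) by (intro power_mono) (simp_all flip: powr_add)
      then have "Cl * (Cd powr (q / p) * (2 powr (n * q / p)) ^ Suc k) * L x r
        \<le> Cl * (Cd powr (q / p) * (2 powr e * 2 powr \<alpha>) ^ Suc k) * L x r"
        using Cl(1) L_pos[OF x] by (intro mult_right_mono mult_left_mono) auto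
      ultimately have "L x ?R' * v \<le> Cl * (Cd powr (q / p) * (2 powr e * 2 powr \<alpha>) ^ Suc k) * L x r * v"
        using v by (intro mult_right_mono) auto
      also have "\<dots> = Cl * Cd powr (q / p) * 2 powr \<alpha> * (2 powr e) ^ Suc k * L x r * ((2 powr \<alpha>) ^ k * v)"
        by (simp add: power_mult_distrib)
      also have "\<dots> \<le> Cl * Cd powr (q / p) * 2 powr \<alpha> * (2 powr e) ^ Suc k * L x r * (Cr * v')"
        using lower Cl(1) L_pos[OF x] unfolding v_def v'_def by (intro mult_left_mono) auto
      also have "\<dots> = (Cl * Cd powr (q / p) * Cr * 2 powr \<alpha>) * ((2 powr e) ^ Suc k * L x r * v')"
        by simp
      also have "\<dots> \<le> C * ((2 powr e) ^ Suc k * L x r * v')"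
        using L_pos[OF x] v unfolding C_def by (intro mult_right_mono) auto
      finally show ?thesis
        by (simp add: v_def v'_def mult.assoc)
    qed
  qed
  then show ?thesis
    by (intro exI[of _ C]) (auto simp: C_def)
qed

end

section \<open>Means and oscillations on a single ball\<close>

context homogeneous_space
begin

text \<open>The function is the pointwise limit of its truncations to balls around one fixed
  point.\<close>

lemma locally_integrable_measurable:
  fixes f :: "'a \<Rightarrow> 'k::{real_normed_field,banach,second_countable_topology}"
  assumes "locally_integrable \<mu> d f"
  shows "f \<in> borel_measurable \<mu>"
proof -
  obtain x where x: "x \<in> space \<mu>"
    using space_nonempty by blast
  show ?thesis
  proof (rule borel_measurable_LIMSEQ_metric)
    \<comment> \<open>The radius is \<open>Suc k\<close> because local integrability speaks of
      positive radii only.\<close>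
    show "(\<lambda>y. indicator (B x (real (Suc k))) y *\<^sub>R f y) \<in> borel_measurable \<mu>" for k
      using assms x unfolding locally_integrable_def set_integrable_def
      by (auto intro!: borel_measurable_integrable)
    fix y assume y: "y \<in> space \<mu>"
    obtain k0 :: nat where "d y x < real k0"
      using reals_Archimedean2 by blast
    then have "eventually (\<lambda>k. indicator (B x (real (Suc k))) y *\<^sub>R f y = f y) sequentially"
      using y by (intro eventually_sequentiallyI[of k0]) (auto simp: qball_def indicator_def)
    then show "(\<lambda>k. indicator (B x (real (Suc k))) y *\<^sub>R f y) \<longlonglongrightarrow> f y"
      by (rule tendsto_eventually)
  qed
qed

lemma norm_mean_diff_le:
  fixes f :: "'a \<Rightarrow> 'k::{real_normed_field,banach,second_countable_topology}"
  assumes f: "locally_integrable \<mu> d f" and x: "x \<in> space \<mu>" "0 < r"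
  shows "ennreal (norm (mean \<mu> (B x r) f - c) * V x r) \<le> (\<integral>\<^sup>+y\<in>B x r. ennreal (norm (f y - c)) \<partial>\<mu>)"
proof -
  have sets [measurable]: "B x r \<in> sets \<mu>"
    using x by (rule sets_ball)
  have int: "set_integrable \<mu> (B x r) f" "set_integrable \<mu> (B x r) (\<lambda>_. c)"
    using f x emeasure_ball_finite[OF x] sets
    by (auto simp: locally_integrable_def set_integrable_def)
  have "(LINT y:B x r|\<mu>. c) = V x r *\<^sub>R c"
    using emeasure_ball_finite[OF x] sets by (simp add: V_def set_lebesgue_integral_def)
  then have "(LINT y:B x r|\<mu>. f y - c) = (LINT y:B x r|\<mu>. f y) - V x r *\<^sub>R c"
    using set_integral_diff(2)[OF int] by simp
  also have "\<dots> = V x r *\<^sub>R (mean \<mu> (B x r) f - c)"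
    using V_pos[OF x] by (simp add: mean_def V_def scaleR_diff_right)
  finally have "norm (mean \<mu> (B x r) f - c) * V x r = norm (LINT y:B x r|\<mu>. f y - c)"
    using V_pos[OF x] by simp
  also have "ennreal \<dots> \<le> (\<integral>\<^sup>+y. ennreal (norm (indicator (B x r) y *\<^sub>R (f y - c))) \<partial>\<mu>)"
    unfolding set_lebesgue_integral_def
    using set_integral_diff(1)[OF int] unfolding set_integrable_def
    by (intro integral_norm_bound_ennreal)
  also have "\<dots> = (\<integral>\<^sup>+y\<in>B x r. ennreal (norm (f y - c)) \<partial>\<mu>)"
    by (intro nn_integral_cong) (auto simp: indicator_def)
  finally show ?thesis .
qed

lemma nn_integral_ball_const:
  "x \<in> space \<mu> \<Longrightarrow> 0 < r \<Longrightarrow> 0 \<le> c \<Longrightarrow> (\<integral>\<^sup>+y\<in>B x r. ennreal c \<partial>\<mu>) = ennreal (c * V x r)"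
  by (simp add: nn_integral_cmult_indicator sets_ball emeasure_ball ennreal_mult')

lemma nn_integral_ball_triangle:
  fixes f :: "'a \<Rightarrow> 'k::{real_normed_field,banach,second_countable_topology}"
  assumes f: "f \<in> borel_measurable \<mu>" and x: "x \<in> space \<mu>" "0 < r"
  shows "(\<integral>\<^sup>+y\<in>B x r. ennreal (norm (f y - c)) \<partial>\<mu>) \<le>
    (\<integral>\<^sup>+y\<in>B x r. ennreal (norm (f y - c')) \<partial>\<mu>) + ennreal (norm (c' - c) * V x r)"
proof -
  note [measurable] = f sets_ball[OF x]
  have "(\<integral>\<^sup>+y\<in>B x r. ennreal (norm (f y - c)) \<partial>\<mu>) \<le>
    (\<integral>\<^sup>+y. ennreal (norm (f y - c')) * indicator (B x r) y + ennreal (norm (c' - c)) * indicator (B x r) y \<partial>\<mu>)"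
    using norm_triangle_ineq[of "f y - c'" "c' - c" for y]
    by (intro nn_integral_mono) (auto simp: indicator_def simp flip: ennreal_plus intro!: ennreal_leI)
  also have "\<dots> = (\<integral>\<^sup>+y\<in>B x r. ennreal (norm (f y - c')) \<partial>\<mu>) + ennreal (norm (c' - c) * V x r)"
    using x by (subst nn_integral_add) (auto simp: nn_integral_ball_const)
  finally show ?thesis .
qed

end

context growth_space
begin

lemma BMO_ball:
  fixes f :: "'a \<Rightarrow> 'k::{real_normed_field,banach,second_countable_topology}"
  assumes f: "f \<in> BMO \<mu> d \<phi>" and x: "x \<in> space \<mu>" "0 < r"
  shows "(\<integral>\<^sup>+y\<in>B x r. ennreal (norm (f y - mean \<mu> (B x r) f)) \<partial>\<mu>)
    \<le> ennreal (enn2real (BMO_norm \<mu> d \<phi> f) * L x r)"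
proof -
  let ?I = "(\<integral>\<^sup>+y\<in>B x r. ennreal (norm (f y - mean \<mu> (B x r) f)) \<partial>\<mu>)"
  have "?I / lux x r \<le> BMO_norm \<mu> d \<phi> f"
    unfolding BMO_norm_def using x
    by - (rule SUP_upper2[of x], simp, rule SUP_upper2[of r], simp_all)
  also have "\<dots> = ennreal (enn2real (BMO_norm \<mu> d \<phi> f))"
    using f by (simp add: BMO_def)
  finally have "?I / ennreal (L x r) * ennreal (L x r)
    \<le> ennreal (enn2real (BMO_norm \<mu> d \<phi> f)) * ennreal (L x r)"
    using x by (intro mult_right_mono) (simp_all add: lux_real)
  moreover have "?I / ennreal (L x r) * ennreal (L x r) = ?I"
    using L_pos[OF x] by (simp add: ennreal_divide_times ennreal_mult_divide_eq)
  ultimately show ?thesis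
    using L_pos[OF x] by (simp add: ennreal_mult'')
qed

end

section \<open>Telescoping of means over dyadic dilates\<close>

context admissible_exponents
begin

text \<open>Let \<open>c k\<close> be the mean over the \<open>k\<close>-th dilate. Consecutive
  means differ by at most a multiple of the oscillation on the larger ball, of order
  \<open>(2 powr e) ^ k\<close> by \<open>L_dyadic\<close>. Summing and adding the oscillation
  around \<open>c k\<close> gives the bound, with \<open>A\<close> independent of the function and
  the ball.\<close>

lemma BMO_dyadic:
  "\<exists>A>0. \<forall>f\<in>BMO \<mu> d \<phi>. \<forall>x\<in>space \<mu>. \<forall>r>0. \<forall>k.
     (\<integral>\<^sup>+y\<in>B x (2 ^ k * r). ennreal (norm (f y - mean \<mu> (B x r) f :: 'k::{real_normed_field,banach,second_countable_topology})) \<partial>\<mu>)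
     \<le> ennreal (A * enn2real (BMO_norm \<mu> d \<phi> f) * (2 powr e) ^ k * V x (2 ^ k * r) * (L x r / V x r))"
proof -
  obtain Cl where Cl: "Cl \<ge> 1" "\<forall>x\<in>space \<mu>. \<forall>r>0. \<forall>k.
     L x (2 ^ k * r) * V x r \<le> Cl * (2 powr e) ^ k * L x r * V x (2 ^ k * r)"
    using L_dyadic by blast
  obtain C2 where C2: "C2 \<ge> 1" "\<forall>x\<in>space \<mu>. \<forall>r>0. V x (2 * r) \<le> C2 * V x r"
    using V_doubling by blast
  define E where "E = 2 powr e"
  have E: "1 < E"
    using e by (simp add: E_def gr_one_powr)
  \<comment> \<open>The solution of \<open>K + C2 * Cl * E = K * E\<close>, so that the telescoping
    induction reproduces its own constant.\<close>
  define K where "K = C2 * Cl * E / (E - 1)"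
  have K: "0 < K" "K + C2 * Cl * E = K * E"
    using C2 Cl E by (auto simp: K_def field_simps)
  have "(\<integral>\<^sup>+y\<in>B x (2 ^ k * r). ennreal (norm (f y - mean \<mu> (B x r) f)) \<partial>\<mu>)
     \<le> ennreal ((Cl + K) * enn2real (BMO_norm \<mu> d \<phi> f) * E ^ k * V x (2 ^ k * r) * (L x r / V x r))"
    if f: "f \<in> BMO \<mu> d \<phi>" and x: "x \<in> space \<mu>" "0 < r" for f :: "'a \<Rightarrow> 'k" and x r k
  proof -
    define N where "N = enn2real (BMO_norm \<mu> d \<phi> f)"
    define \<rho> where "\<rho> = L x r / V x r"
    define c where "c k = mean \<mu> (B x (2 ^ k * r)) f" for k :: nat
    have \<rho>: "0 < \<rho>" and N: "0 \<le> N"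
      using L_pos[OF x] V_pos[OF x] by (auto simp: \<rho>_def N_def)
    have Vk: "0 < V x (2 ^ k * r)" for k :: nat
      using x by (intro V_pos) auto
    have loc: "locally_integrable \<mu> d f"
      using f by (simp add: BMO_def)
    have Lk: "L x (2 ^ k * r) \<le> Cl * E ^ k * \<rho> * V x (2 ^ k * r)" for k :: nat
      using Cl(2)[rule_format, OF x, of k] V_pos[OF x] by (simp add: \<rho>_def E_def field_simps)
    have osc: "(\<integral>\<^sup>+y\<in>B x (2 ^ k * r). ennreal (norm (f y - c k)) \<partial>\<mu>) \<le> ennreal (N * L x (2 ^ k * r))" for k :: nat
      using BMO_ball[OF f, of x "2 ^ k * r"] x by (simp add: c_def N_def)
    have step: "norm (c k - c (Suc k)) \<le> N * (C2 * Cl * E * E ^ k * \<rho>)" for k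
    proof -
      have "ennreal (norm (c k - c (Suc k)) * V x (2 ^ k * r))
        \<le> (\<integral>\<^sup>+y\<in>B x (2 ^ k * r). ennreal (norm (f y - c (Suc k))) \<partial>\<mu>)"
        unfolding c_def using x by (intro norm_mean_diff_le loc) auto
      also have "\<dots> \<le> (\<integral>\<^sup>+y\<in>B x (2 ^ Suc k * r). ennreal (norm (f y - c (Suc k))) \<partial>\<mu>)"
        using ball_mono[of "2 ^ k * r" "2 ^ Suc k * r" x] x
        by (intro nn_integral_mono) (auto simp: indicator_def)
      also have "\<dots> \<le> ennreal (N * L x (2 ^ Suc k * r))"
        by (rule osc)
      finally have "norm (c k - c (Suc k)) * V x (2 ^ k * r) \<le> N * L x (2 ^ Suc k * r)"
        using N L_pos[of x "2 ^ Suc k * r"] x by (subst (asm) ennreal_le_iff) auto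
      also have "\<dots> \<le> N * (Cl * E ^ Suc k * \<rho> * V x (2 ^ Suc k * r))"
        using N by (intro mult_left_mono Lk)
      also have "\<dots> \<le> N * (Cl * E ^ Suc k * \<rho> * (C2 * V x (2 ^ k * r)))"
        using N Cl(1) E \<rho> C2(2)[rule_format, of x "2 ^ k * r"] x
        by (intro mult_left_mono) (auto simp: mult.assoc)
      finally have "norm (c k - c (Suc k)) * V x (2 ^ k * r)
        \<le> (N * (C2 * Cl * E * E ^ k * \<rho>)) * V x (2 ^ k * r)"
        by (simp add: mult_ac)
      then show ?thesis
        using Vk[of k] by (simp only: mult_le_cancel_right)
    qed
    have tele: "norm (c k - c 0) \<le> N * (K * E ^ k * \<rho>)" for k
    proof (induction k)
      case 0
      show ?case using N K \<rho> by simp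
    next
      case (Suc k)
      have "norm (c (Suc k) - c 0) \<le> norm (c (Suc k) - c k) + norm (c k - c 0)"
        using norm_triangle_ineq[of "c (Suc k) - c k" "c k - c 0"] by simp
      also have "\<dots> \<le> N * (C2 * Cl * E * E ^ k * \<rho>) + N * (K * E ^ k * \<rho>)"
        using step[of k] Suc by (simp add: norm_minus_commute)
      also have "\<dots> = N * ((K + C2 * Cl * E) * E ^ k * \<rho>)"
        by (simp add: algebra_simps)
      also have "\<dots> = N * (K * E ^ Suc k * \<rho>)"
        unfolding K(2) by (simp add: mult_ac)
      finally show ?case .
    qed
    have "(\<integral>\<^sup>+y\<in>B x (2 ^ k * r). ennreal (norm (f y - c 0)) \<partial>\<mu>) \<le>
      (\<integral>\<^sup>+y\<in>B x (2 ^ k * r). ennreal (norm (f y - c k)) \<partial>\<mu>) + ennreal (norm (c k - c 0) * V x (2 ^ k * r))"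
      using x by (intro nn_integral_ball_triangle locally_integrable_measurable loc) auto
    also have "\<dots> \<le> ennreal (N * (Cl * E ^ k * \<rho> * V x (2 ^ k * r))) + ennreal (N * (K * E ^ k * \<rho>) * V x (2 ^ k * r))"
      using osc[of k] Lk[of k] tele[of k] N Vk[of k]
      by (intro add_mono ennreal_leI mult_right_mono)
        (auto intro!: order_trans[OF osc] ennreal_leI mult_left_mono)
    also have "\<dots> = ennreal ((Cl + K) * N * E ^ k * V x (2 ^ k * r) * \<rho>)"
      using N Cl(1) E \<rho> K Vk[of k] by (simp add: algebra_simps flip: ennreal_plus)
    finally show ?thesis
      by (simp add: c_def \<rho>_def N_def)
  qed
  then show ?thesis
    using Cl(1) K(1) unfolding E_def by (intro exI[of _ "Cl + K"]) auto
qed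

end

section \<open>Generalized approximations to the identity\<close>

text \<open>For large \<open>u\<close> the limit gives \<open>g (u powr m) < u powr (- M)\<close>,
  comparable to \<open>(1 + u) powr (- M)\<close>; for the remaining bounded range of
  \<open>u\<close> the boundedness of \<open>g\<close> suffices.\<close>

lemma polynomial_decay:
  fixes g :: "real \<Rightarrow> real"
  assumes m: "0 < m" and M: "0 < M" and pos: "\<forall>r\<ge>0. 0 < g r" and bdd: "bounded (g ` {0..})"
    and lim: "((\<lambda>r. r powr M * g (r powr m)) \<longlongrightarrow> 0) at_top"
  shows "\<exists>K>0. \<forall>u\<ge>0. g (u powr m) \<le> K * (1 + u) powr (- M)"
proof -
  obtain G where G: "\<And>r. 0 \<le> r \<Longrightarrow> \<bar>g r\<bar> \<le> G"
    using bdd by (auto simp: bounded_real)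
  have G0: "0 < G"
    using G[of 0] pos[rule_format, of 0] by auto
  have "eventually (\<lambda>r. r powr M * g (r powr m) < 1) at_top"
    using order_tendstoD(2)[OF lim] by auto
  then obtain R where R: "\<And>r. R \<le> r \<Longrightarrow> r powr M * g (r powr m) < 1"
    by (auto simp: eventually_at_top_linorder)
  \<comment> \<open>From \<open>u \<ge> 1\<close> on, \<open>(1 + u) / 2 \<le> u\<close>, which is
    the source of the constant \<open>2 powr M\<close>.\<close>
  define R' where "R' = max R 1"
  define K where "K = max (2 powr M) (G * (1 + R') powr M)"
  have R': "1 \<le> R'" "R \<le> R'"
    by (auto simp: R'_def)
  have "g (u powr m) \<le> K * (1 + u) powr (- M)" if u: "0 \<le> u" for u
  proof (cases "R' \<le> u")
    case True
    then have u1: "1 \<le> u"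
      using R' by simp
    have "g (u powr m) \<le> 1 / u powr M"
      using R[of u] True R' u1 by (simp add: field_simps)
    also have "\<dots> \<le> 1 / ((1 + u) / 2) powr M"
      using u1 M by (intro divide_left_mono powr_mono2) auto
    also have "\<dots> = 2 powr M * (1 + u) powr (- M)"
      using u1 by (simp add: powr_divide powr_minus_divide)
    also have "\<dots> \<le> K * (1 + u) powr (- M)"
      by (intro mult_right_mono) (auto simp: K_def)
    finally show ?thesis .
  next
    case False
    have "g (u powr m) \<le> G * 1"
      using G[of "u powr m"] by auto
    also have "1 = (1 + u) powr M * (1 + u) powr (- M)"
      using u by (simp flip: powr_add)
    also have "G * \<dots> \<le> G * ((1 + R') powr M * (1 + u) powr (- M))"
      using False u M G0 by (intro mult_left_mono mult_right_mono powr_mono2) auto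
    also have "\<dots> \<le> K * (1 + u) powr (- M)"
      unfolding K_def mult.assoc[symmetric] by (intro mult_right_mono) auto
    finally show ?thesis .
  qed
  moreover have "0 < K"
    by (simp add: K_def less_max_iff_disj)
  ultimately show ?thesis by blast
qed

text \<open>The gap \<open>n + e < M\<close> makes kernel decay outweigh both the growth of the
  balls and that of the mean oscillations.\<close>

locale kernel_setting = admissible_exponents +
  fixes M m :: real and g :: "real \<Rightarrow> real"
    and a :: "real \<Rightarrow> 'a \<Rightarrow> 'a \<Rightarrow> 'k::{real_normed_field,banach,second_countable_topology}"
  assumes approx_identity: "generalized_approx_identity \<mu> d \<phi> M m g a"
    and M_gt: "n + e < M"
begin

section \<open>Size of the kernel and its action on oscillations\<close>

lemma m_pos: "0 < m"
  and kernel_bound: "0 < t \<Longrightarrow> x \<in> space \<mu> \<Longrightarrow> y \<in> space \<mu> \<Longrightarrow>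
        norm (a t x y) \<le> g (d x y powr m / t) / V x (t powr (1 / m))"
  using approx_identity by (auto simp: generalized_approx_identity_def V_def)

lemma kernel_measurable:
  assumes "0 < t" "x \<in> space \<mu>"
  shows "a t x \<in> borel_measurable \<mu>"
proof -
  have "(\<lambda>(x, y). a t x y) \<in> borel_measurable (\<mu> \<Otimes>\<^sub>M \<mu>)"
    using approx_identity assms(1) by (simp add: generalized_approx_identity_def)
  from measurable_compose[OF measurable_Pair1'[OF assms(2)] this] show ?thesis
    by simp
qed

text \<open>Each \<open>y\<close> is assigned one dilate containing it, at whose level the kernel
  has the expected size. This allows the kernel to be dominated by a series over full balls, without
  splitting the space into annuli.\<close>

lemma kernel_dyadic:
  "\<exists>K>0. \<forall>x\<in>space \<mu>. \<forall>r>0. \<forall>z\<in>B x r. \<forall>y\<in>space \<mu>.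
     \<exists>k. y \<in> B x (2 ^ k * r) \<and> norm (a (r powr m) z y) \<le> K * (2 powr (- M)) ^ k / V x r"
proof -
  have M: "0 < M"
    using M_gt n_pos e by simp
  have "\<forall>r\<ge>0. 0 < g r" "bounded (g ` {0..})" "((\<lambda>r. r powr M * g (r powr m)) \<longlongrightarrow> 0) at_top"
    using approx_identity by (simp_all add: generalized_approx_identity_def)
  from polynomial_decay[OF m_pos M this]
  obtain K where K: "K > 0" "\<forall>u\<ge>0. g (u powr m) \<le> K * (1 + u) powr (- M)"
    by blast
  obtain C1 where C1: "C1 \<ge> 1"
    "\<forall>x\<in>space \<mu>. \<forall>y\<in>space \<mu>. \<forall>z\<in>space \<mu>. d x y \<le> C1 * (d x z + d z y)"
    using quasi_triangle by blast
  obtain Cb where Cb: "Cb \<ge> 1"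
    "\<forall>x\<in>space \<mu>. \<forall>y\<in>space \<mu>. \<forall>r. d x y \<le> r \<longrightarrow> B x r \<subseteq> B y (Cb * r)"
    using ball_subset_ball by blast
  obtain Cd where Cd: "Cd > 0" "\<forall>x\<in>space \<mu>. \<forall>r>0. \<forall>l\<ge>1. V x (l * r) \<le> Cd * l powr n * V x r"
    using cond_D_n unfolding cond_D_iff by blast
  define D where "D = Cd * Cb powr n"
  have D: "0 < D"
    using Cd Cb by (simp add: D_def)
  have "\<exists>k. y \<in> B x (2 ^ k * r) \<and>
      norm (a (r powr m) z y) \<le> (K * (2 * C1) powr M * D) * (2 powr (- M)) ^ k / V x r"
    if x: "x \<in> space \<mu>" "0 < r" and z: "z \<in> B x r" and y: "y \<in> space \<mu>" for x r z y
  proof -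
    have zs: "z \<in> space \<mu>" "d z x < r" "d x z \<le> r"
      using z x dist_sym[of x z] by (auto simp: qball_def)
    define u where "u = d z y / r"
    have u: "0 \<le> u"
      using dist_nonneg zs(1) y x by (simp add: u_def)
    \<comment> \<open>Minimality makes \<open>y\<close> far from the centre, so that
      \<open>1 + u\<close> is at least of order \<open>2 ^ k\<close>.\<close>
    define k where "k = (LEAST k. d y x < 2 ^ k * r)"
    obtain j where "d y x / r < 2 ^ j"
      using real_arch_pow[of 2 "d y x / r"] by auto
    then have "d y x < 2 ^ j * r"
      using x by (simp add: field_simps)
    then have k: "d y x < 2 ^ k * r"
      unfolding k_def by (rule LeastI)
    have far: "2 ^ k \<le> 2 * C1 * (1 + u)"
    proof (cases k)
      case 0
      have "1 \<le> C1 * (1 + u)"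
        using C1(1) u mult_mono[of 1 C1 1 "1 + u"] by auto
      with 0 show ?thesis by simp
    next
      case (Suc j)
      then have "\<not> d y x < 2 ^ j * r"
        using not_less_Least[of j "\<lambda>k. d y x < 2 ^ k * r"] by (simp add: k_def)
      then have "2 ^ j * r \<le> C1 * (d y z + d z x)"
        using C1(2)[rule_format, OF y x(1) zs(1)] by linarith
      also have "\<dots> \<le> C1 * (d z y + r)"
        using C1(1) zs dist_sym[OF y zs(1)] by (intro mult_left_mono) auto
      also have "\<dots> = C1 * (1 + u) * r"
        using x by (simp add: u_def field_simps)
      finally have "2 ^ j \<le> C1 * (1 + u)"
        using x by simp
      with Suc show ?thesis by simp
    qed
    have "(1 + u) powr (- M) \<le> (2 ^ k / (2 * C1)) powr (- M)"
      using far C1(1) M by (intro powr_mono2') (auto simp: field_simps)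
    also have "\<dots> = (2 * C1) powr M * (2 powr (- M)) ^ k"
      using C1(1) by (simp add: powr_divide powr_power_commute powr_minus_divide power_divide)
    finally have decay: "(1 + u) powr (- M) \<le> (2 * C1) powr M * (2 powr (- M)) ^ k" .
    \<comment> \<open>The kernel is normalised by the ball around \<open>z\<close>; it has to be
      compared with the fixed ball around \<open>x\<close>.\<close>
    have "V x r \<le> V z (Cb * r)"
      using Cb x zs by (intro V_mono_subset) auto
    also have "\<dots> \<le> D * V z r"
      using Cd(2) zs(1) x(2) Cb(1) unfolding D_def by blast
    finally have V: "1 / V z r \<le> D / V x r"
      using V_pos[OF x] V_pos[OF zs(1) x(2)] by (simp add: field_simps)
    have "norm (a (r powr m) z y) \<le> g (d z y powr m / r powr m) / V z ((r powr m) powr (1 / m))"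
      using x zs y by (intro kernel_bound) auto
    also have "\<dots> = g (u powr m) / V z r"
      using x m_pos zs y dist_nonneg[OF zs(1) y] by (simp add: u_def powr_divide powr_powr)
    also have "\<dots> \<le> (K * ((2 * C1) powr M * (2 powr (- M)) ^ k)) / V z r"
      using K(2)[rule_format, OF u] decay K(1) V_pos[OF zs(1) x(2)]
      by (intro divide_right_mono order_trans[OF K(2)[rule_format, OF u]] mult_left_mono) auto
    also have "\<dots> = (K * ((2 * C1) powr M * (2 powr (- M)) ^ k)) * (1 / V z r)"
      by simp
    also have "\<dots> \<le> (K * ((2 * C1) powr M * (2 powr (- M)) ^ k)) * (D / V x r)"
      using V K(1) by (intro mult_left_mono) auto
    finally have "norm (a (r powr m) z y) \<le> (K * (2 * C1) powr M * D) * (2 powr (- M)) ^ k / V x r"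
      by (simp add: mult_ac)
    with k y show ?thesis
      by (auto simp: qball_def)
  qed
  moreover have "0 < K * (2 * C1) powr M * D"
    using K(1) C1(1) D by simp
  ultimately show ?thesis by blast
qed

text \<open>Level \<open>k\<close> contributes \<open>2 powr (- M)\<close> from the kernel,
  \<open>2 powr e\<close> from the mean oscillation and \<open>2 powr n\<close> from the volume,
  each to the power \<open>k\<close>. The product \<eta> of the three is below 1 by
  \<open>M_gt\<close>, so the series is geometric.\<close>

lemma kernel_oscillation:
  "\<exists>H>0. \<forall>f\<in>BMO \<mu> d \<phi>. \<forall>x\<in>space \<mu>. \<forall>r>0. \<forall>z\<in>B x r.
     (\<integral>\<^sup>+y. ennreal (norm (a (r powr m) z y * (f y - mean \<mu> (B x r) f))) \<partial>\<mu>)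
     \<le> ennreal (H * enn2real (BMO_norm \<mu> d \<phi> f) * (L x r / V x r))"
proof -
  obtain A where A: "A > 0" "\<forall>f\<in>BMO \<mu> d \<phi>. \<forall>x\<in>space \<mu>. \<forall>r>0. \<forall>k.
     (\<integral>\<^sup>+y\<in>B x (2 ^ k * r). ennreal (norm (f y - mean \<mu> (B x r) f :: 'k)) \<partial>\<mu>)
     \<le> ennreal (A * enn2real (BMO_norm \<mu> d \<phi> f) * (2 powr e) ^ k * V x (2 ^ k * r) * (L x r / V x r))"
    using BMO_dyadic[where 'k='k] by blast
  obtain K where K: "K > 0" "\<forall>x\<in>space \<mu>. \<forall>r>0. \<forall>z\<in>B x r. \<forall>y\<in>space \<mu>.
     \<exists>k. y \<in> B x (2 ^ k * r) \<and> norm (a (r powr m) z y) \<le> K * (2 powr (- M)) ^ k / V x r"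
    using kernel_dyadic by blast
  obtain C where C: "C > 0" "\<forall>x\<in>space \<mu>. \<forall>r>0. \<forall>k. V x (2 ^ k * r) \<le> C * (2 powr n) ^ k * V x r"
    using V_dyadic by blast
  define \<eta> where "\<eta> = 2 powr (- M) * 2 powr e * 2 powr n"
  have "\<eta> = 2 powr (- M + e + n)"
    unfolding \<eta>_def powr_add ..
  then have \<eta>: "0 < \<eta>" "\<eta> < 1"
    using M_gt powr_less_cancel_iff[of 2 "- M + e + n" 0] by auto
  have "(\<integral>\<^sup>+y. ennreal (norm (a (r powr m) z y * (f y - mean \<mu> (B x r) f))) \<partial>\<mu>)
     \<le> ennreal ((K * A * C / (1 - \<eta>)) * enn2real (BMO_norm \<mu> d \<phi> f) * (L x r / V x r))"
    if f: "f \<in> BMO \<mu> d \<phi>" and x: "x \<in> space \<mu>" "0 < r" and z: "z \<in> B x r" for f x r z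
  proof -
    define c where "c = mean \<mu> (B x r) f"
    define N where "N = enn2real (BMO_norm \<mu> d \<phi> f)"
    define \<rho> where "\<rho> = L x r / V x r"
    have \<rho>: "0 < \<rho>" and N: "0 \<le> N"
      using L_pos[OF x] V_pos[OF x] by (auto simp: \<rho>_def N_def)
    have [measurable]: "f \<in> borel_measurable \<mu>"
      using f by (intro locally_integrable_measurable) (simp add: BMO_def)
    have [measurable]: "B x (2 ^ k * r) \<in> sets \<mu>" for k :: nat
      using x by (intro sets_ball) auto
    let ?F = "\<lambda>k y. ennreal (K * (2 powr (- M)) ^ k / V x r) *
      (ennreal (norm (f y - c)) * indicator (B x (2 ^ k * r)) y)"
    have "(\<integral>\<^sup>+y. ennreal (norm (a (r powr m) z y * (f y - c))) \<partial>\<mu>) \<le> (\<integral>\<^sup>+y. (\<Sum>k. ?F k y) \<partial>\<mu>)"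
    proof (rule nn_integral_mono)
      fix y assume y: "y \<in> space \<mu>"
      obtain k where k: "y \<in> B x (2 ^ k * r)" "norm (a (r powr m) z y) \<le> K * (2 powr (- M)) ^ k / V x r"
        using K(2) x z y by blast
      have "ennreal (norm (a (r powr m) z y * (f y - c))) \<le>
        ennreal ((K * (2 powr (- M)) ^ k / V x r) * norm (f y - c))"
        unfolding norm_mult using k(2) by (intro ennreal_leI mult_right_mono) auto
      also have "\<dots> = ?F k y"
        unfolding ennreal_mult''[OF norm_ge_zero] using k(1) by simp
      also have "\<dots> \<le> (\<Sum>k. ?F k y)"
        using sum_le_suminf[of "\<lambda>k. ?F k y" "{k}"] by (simp add: summableI)
      finally show "ennreal (norm (a (r powr m) z y * (f y - c))) \<le> (\<Sum>k. ?F k y)" .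
    qed
    also have "\<dots> = (\<Sum>k. \<integral>\<^sup>+y. ?F k y \<partial>\<mu>)"
      by (intro nn_integral_suminf) measurable
    also have "\<dots> \<le> (\<Sum>k. ennreal (K * A * C * N * \<rho> * \<eta> ^ k))"
    proof (rule suminf_le)
      fix k
      have "(\<integral>\<^sup>+y. ?F k y \<partial>\<mu>) = ennreal (K * (2 powr (- M)) ^ k / V x r) *
          (\<integral>\<^sup>+y\<in>B x (2 ^ k * r). ennreal (norm (f y - c)) \<partial>\<mu>)"
        by (intro nn_integral_cmult) measurable
      also have "\<dots> \<le> ennreal (K * (2 powr (- M)) ^ k / V x r) *
         ennreal (A * N * (2 powr e) ^ k * V x (2 ^ k * r) * \<rho>)"
        using A(2)[rule_format, OF f x, of k] unfolding c_def N_def \<rho>_def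
        by (intro mult_left_mono) auto
      also have "\<dots> = ennreal (K * (2 powr (- M)) ^ k / V x r * (A * N * (2 powr e) ^ k * V x (2 ^ k * r) * \<rho>))"
        using K(1) V_pos[OF x] by (intro ennreal_mult'[symmetric]) auto
      also have "\<dots> \<le> ennreal (K * (2 powr (- M)) ^ k / V x r * (A * N * (2 powr e) ^ k * (C * (2 powr n) ^ k * V x r) * \<rho>))"
        using K(1) A(1) V_pos[OF x] N \<rho> C(2)[rule_format, OF x, of k]
        by (intro ennreal_leI mult_left_mono mult_right_mono) auto
      also have "K * (2 powr (- M)) ^ k / V x r * (A * N * (2 powr e) ^ k * (C * (2 powr n) ^ k * V x r) * \<rho>)
        = K * A * C * N * \<rho> * \<eta> ^ k"
        using V_pos[OF x] by (simp add: \<eta>_def power_mult_distrib)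
      finally show "(\<integral>\<^sup>+y. ?F k y \<partial>\<mu>) \<le> ennreal (K * A * C * N * \<rho> * \<eta> ^ k)" .
    qed (auto intro: summableI)
    also have "\<dots> = ennreal (K * A * C * N * \<rho> * (1 / (1 - \<eta>)))"
      using K(1) A(1) C(1) N \<rho> \<eta>
      by (intro suminf_ennreal_eq sums_mult geometric_sums) auto
    also have "K * A * C * N * \<rho> * (1 / (1 - \<eta>)) = (K * A * C / (1 - \<eta>)) * N * \<rho>"
      by simp
    finally show ?thesis
      by (simp add: c_def N_def \<rho>_def)
  qed
  moreover have "0 < K * A * C / (1 - \<eta>)"
    using K(1) A(1) C(1) \<eta> by simp
  ultimately show ?thesis by blast
qed

text \<open>As the kernel has integral 1, the operator reproduces the constant \<open>c\<close>,
  hence \<open>f - A f = (f - c) - A (f - c)\<close>. This also splits the integrand of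
  \<open>A f\<close> into two integrable parts.\<close>

lemma approx_op_center:
  assumes f: "f \<in> BMO \<mu> d \<phi>" and x: "x \<in> space \<mu>" "0 < r" and z: "z \<in> B x r"
    and one: "(LINT y|\<mu>. a (r powr m) z y) = 1"
  shows "integrable \<mu> (\<lambda>y. a (r powr m) z y * f y)"
    and "ennreal (norm (f z - approx_op \<mu> a (r powr m) f z)) \<le> ennreal (norm (f z - mean \<mu> (B x r) f)) +
      (\<integral>\<^sup>+y. ennreal (norm (a (r powr m) z y * (f y - mean \<mu> (B x r) f))) \<partial>\<mu>)"
proof -
  define c where "c = mean \<mu> (B x r) f"
  define k where "k = a (r powr m) z"
  obtain H where "(\<integral>\<^sup>+y. ennreal (norm (k y * (f y - c))) \<partial>\<mu>)
     \<le> ennreal (H * enn2real (BMO_norm \<mu> d \<phi> f) * (L x r / V x r))"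
    using kernel_oscillation f x z unfolding k_def c_def by blast
  then have fin: "(\<integral>\<^sup>+y. ennreal (norm (k y * (f y - c))) \<partial>\<mu>) < \<infinity>"
    by (rule le_less_trans) simp
  have [measurable]: "f \<in> borel_measurable \<mu>"
    using f by (intro locally_integrable_measurable) (simp add: BMO_def)
  have [measurable]: "k \<in> borel_measurable \<mu>"
    using z x unfolding k_def by (intro kernel_measurable) (auto dest: ball_in_space)
  have int1: "integrable \<mu> (\<lambda>y. k y * (f y - c))"
    using fin by (intro integrableI_bounded) auto
  \<comment> \<open>The Bochner integral of a non-integrable function is 0 by convention, so the
    value 1 forces integrability.\<close>
  have "integrable \<mu> k"
    using one not_integrable_integral_eq[of \<mu> k] by (auto simp: k_def)
  then have int2: "integrable \<mu> (\<lambda>y. k y * c)"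
    by simp
  have split: "(\<lambda>y. k y * f y) = (\<lambda>y. k y * (f y - c) + k y * c)"
    by (simp add: algebra_simps)
  show "integrable \<mu> (\<lambda>y. a (r powr m) z y * f y)"
    unfolding k_def[symmetric] split by (rule Bochner_Integration.integrable_add[OF int1 int2])
  have "approx_op \<mu> a (r powr m) f z = (LINT y|\<mu>. k y * (f y - c)) + c"
    unfolding approx_op_def k_def[symmetric] split
    using one int1 int2 by (simp add: k_def)
  then have "norm (f z - approx_op \<mu> a (r powr m) f z) \<le> norm (f z - c) + norm (LINT y|\<mu>. k y * (f y - c))"
    using norm_triangle_ineq4[of "f z - c" "LINT y|\<mu>. k y * (f y - c)"] by (simp add: algebra_simps)
  then have "ennreal (norm (f z - approx_op \<mu> a (r powr m) f z)) \<le>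
      ennreal (norm (f z - c)) + ennreal (norm (LINT y|\<mu>. k y * (f y - c)))"
    by (simp add: ennreal_leI flip: ennreal_plus)
  also have "\<dots> \<le> ennreal (norm (f z - c)) + (\<integral>\<^sup>+y. ennreal (norm (k y * (f y - c))) \<partial>\<mu>)"
    by (intro add_left_mono integral_norm_bound_ennreal int1)
  finally show "ennreal (norm (f z - approx_op \<mu> a (r powr m) f z)) \<le> ennreal (norm (f z - mean \<mu> (B x r) f)) +
      (\<integral>\<^sup>+y. ennreal (norm (a (r powr m) z y * (f y - mean \<mu> (B x r) f))) \<partial>\<mu>)"
    by (simp add: k_def c_def)
qed

text \<open>Every point at which the kernel has integral 1 is taken as the centre of its own ball of
  radius \<open>t powr (1 / m)\<close>.\<close>

lemma approx_op_integrable: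
  assumes f: "f \<in> BMO \<mu> d \<phi>" and t: "0 < t" and one: "AE x in \<mu>. (LINT y|\<mu>. a t x y) = 1"
  shows "AE x in \<mu>. integrable \<mu> (\<lambda>y. a t x y * f y)"
proof -
  have "(t powr (1 / m)) powr m = t" "0 < t powr (1 / m)"
    using t m_pos by (simp_all add: powr_powr)
  then have "integrable \<mu> (\<lambda>y. a t x y * f y)" if "x \<in> space \<mu>" "(LINT y|\<mu>. a t x y) = 1" for x
    using approx_op_center(1)[OF f that(1) _ center_in_ball[OF that(1)], of "t powr (1 / m)"] that(2)
    by simp
  with one show ?thesis by auto
qed

text \<open>On the ball the error splits into \<open>f\<close> minus its mean and a term bounded by
  the constant \<open>h\<close>. Their integrals are at most \<open>N * L x r\<close> and
  \<open>H * N * L x r\<close>, whence the factor \<open>1 + H\<close>.\<close>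

lemma BMO_A_norm_le:
  assumes one: "\<forall>t>0. AE x in \<mu>. (LINT y|\<mu>. a t x y) = 1"
  shows "\<exists>C>0. \<forall>f\<in>BMO \<mu> d \<phi>. BMO_A_norm \<mu> d \<phi> m a f \<le> ennreal C * BMO_norm \<mu> d \<phi> f"
proof -
  obtain H where H: "H > 0" "\<forall>f\<in>BMO \<mu> d \<phi>. \<forall>x\<in>space \<mu>. \<forall>r>0. \<forall>z\<in>B x r.
     (\<integral>\<^sup>+y. ennreal (norm (a (r powr m) z y * (f y - mean \<mu> (B x r) f))) \<partial>\<mu>)
     \<le> ennreal (H * enn2real (BMO_norm \<mu> d \<phi> f) * (L x r / V x r))"
    using kernel_oscillation by blast
  have "BMO_A_norm \<mu> d \<phi> m a f \<le> ennreal (1 + H) * BMO_norm \<mu> d \<phi> f" if f: "f \<in> BMO \<mu> d \<phi>" for f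
  proof -
    define N where "N = enn2real (BMO_norm \<mu> d \<phi> f)"
    have N: "0 \<le> N" "BMO_norm \<mu> d \<phi> f = ennreal N"
      using f by (auto simp: N_def BMO_def)
    have meas: "f \<in> borel_measurable \<mu>"
      using f by (intro locally_integrable_measurable) (simp add: BMO_def)
    have "(\<integral>\<^sup>+z\<in>B x r. ennreal (norm (f z - approx_op \<mu> a (r powr m) f z)) \<partial>\<mu>) / lux x r
      \<le> ennreal (1 + H) * ennreal N"
      if x: "x \<in> space \<mu>" "0 < r" for x r
    proof -
      note [measurable] = meas sets_ball[OF x]
      define h where "h = H * N * (L x r / V x r)"
      have h: "0 \<le> h"
        using H(1) N(1) L_pos[OF x] V_pos[OF x] by (simp add: h_def)
      have AE: "AE z in \<mu>. (LINT y|\<mu>. a (r powr m) z y) = 1"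
        using one x by auto
      have "(\<integral>\<^sup>+z\<in>B x r. ennreal (norm (f z - approx_op \<mu> a (r powr m) f z)) \<partial>\<mu>) \<le>
        (\<integral>\<^sup>+z. ennreal (norm (f z - mean \<mu> (B x r) f)) * indicator (B x r) z + ennreal h * indicator (B x r) z \<partial>\<mu>)"
      proof (rule nn_integral_mono_AE, use AE in eventually_elim)
        case (elim z)
        show ?case
        proof (cases "z \<in> B x r")
          case True
          have "ennreal (norm (f z - approx_op \<mu> a (r powr m) f z)) \<le> ennreal (norm (f z - mean \<mu> (B x r) f)) + ennreal h"
            using approx_op_center(2)[OF f x True elim] H(2)[rule_format, OF f x True]
            unfolding h_def N_def by (meson add_left_mono order_trans)
          then show ?thesis
            using True by simp
        qed simp
      qed
      also have "\<dots> = (\<integral>\<^sup>+z\<in>B x r. ennreal (norm (f z - mean \<mu> (B x r) f)) \<partial>\<mu>) + ennreal (h * V x r)"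
        using x h by (subst nn_integral_add) (auto simp: nn_integral_ball_const)
      also have "\<dots> \<le> ennreal (N * L x r) + ennreal (H * N * L x r)"
        using BMO_ball[OF f x] V_pos[OF x] by (intro add_mono) (simp_all add: N_def h_def)
      also have "\<dots> = ennreal (L x r) * (ennreal (1 + H) * ennreal N)"
        using N(1) H(1) L_pos[OF x]
        by (simp add: algebra_simps flip: ennreal_plus ennreal_mult)
      finally show ?thesis
        using x L_pos[OF x] by (simp add: lux_real divide_le_posI_ennreal)
    qed
    then show ?thesis
      unfolding BMO_A_norm_def N(2) by (intro SUP_least) auto
  qed
  with H(1) show ?thesis
    by (intro exI[of _ "1 + H"]) auto
qed

end

section \<open>The growth class\<close>

context admissible_exponents
begin

text \<open>On the shell \<open>2 ^ k \<le> 1 + d x y < 2 ^ Suc k\<close> the weight in the class is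
  at least \<open>T ^ k * V x (2 ^ Suc k) / C2\<close>, while the integral of
  \<open>norm (f y)\<close> over the ball of radius \<open>2 ^ Suc k\<close> grows at most like
  \<open>E ^ Suc k * V x (2 ^ Suc k)\<close>. The hypothesis on \<beta> gives \<open>E < T\<close>,
  so the sum over shells converges.\<close>

lemma BMO_subset_growth_class_at:
  fixes f :: "'a \<Rightarrow> 'k::{real_normed_field,banach,second_countable_topology}"
  assumes f: "f \<in> BMO \<mu> d \<phi>" and x: "x \<in> space \<mu>"
    and \<beta>: "e < deg_n \<mu> d * weight_index \<mu> d \<phi> / lower_index \<mu> \<phi> - deg_\<alpha> \<mu> d + \<beta>"
  shows "f \<in> growth_class_at \<mu> d \<phi> x \<beta>"
proof -
  obtain A where A: "A > 0" "\<forall>f\<in>BMO \<mu> d \<phi>. \<forall>x\<in>space \<mu>. \<forall>r>0. \<forall>k.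
     (\<integral>\<^sup>+y\<in>B x (2 ^ k * r). ennreal (norm (f y - mean \<mu> (B x r) f :: 'k)) \<partial>\<mu>)
     \<le> ennreal (A * enn2real (BMO_norm \<mu> d \<phi> f) * (2 powr e) ^ k * V x (2 ^ k * r) * (L x r / V x r))"
    using BMO_dyadic[where 'k='k] by blast
  obtain C2 where C2: "C2 \<ge> 1" "\<forall>x\<in>space \<mu>. \<forall>r>0. V x (2 * r) \<le> C2 * V x r"
    using V_doubling by blast
  define \<tau> where "\<tau> = deg_n \<mu> d * weight_index \<mu> d \<phi> / lower_index \<mu> \<phi> - deg_\<alpha> \<mu> d + \<beta>"
  define E T where "E = 2 powr e" and "T = 2 powr \<tau>"
  have E: "1 < E" "E < T"
    using e \<beta> by (auto simp: E_def T_def \<tau>_def gr_one_powr)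
  define c where "c = mean \<mu> (B x 1) f"
  define Q where "Q = A * enn2real (BMO_norm \<mu> d \<phi> f) * (L x 1 / V x 1) + norm c"
  have Q: "0 \<le> Q"
    using A(1) L_pos[OF x, of 1] V_pos[OF x, of 1] by (simp add: Q_def)
  have loc: "locally_integrable \<mu> d f"
    using f by (simp add: BMO_def)
  have meas [measurable]: "f \<in> borel_measurable \<mu>"
    using loc by (rule locally_integrable_measurable)
  have [measurable]: "B x (2 ^ k) \<in> sets \<mu>" for k :: nat
    using x by (intro sets_ball) auto
  have Vk: "0 < V x (2 ^ k)" for k :: nat
    using x by (intro V_pos) auto
  have f_ball: "(\<integral>\<^sup>+y\<in>B x (2 ^ k). ennreal (norm (f y)) \<partial>\<mu>) \<le> ennreal (Q * E ^ k * V x (2 ^ k))" for k :: nat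
  proof -
    have "(\<integral>\<^sup>+y\<in>B x (2 ^ k). ennreal (norm (f y)) \<partial>\<mu>) \<le>
      (\<integral>\<^sup>+y\<in>B x (2 ^ k). ennreal (norm (f y - c)) \<partial>\<mu>) + ennreal (norm c * V x (2 ^ k))"
      using nn_integral_ball_triangle[OF meas x, of "2 ^ k" 0 c] by simp
    \<comment> \<open>The fixed mean \<open>c\<close> is absorbed into the growing bound because
      \<open>E ^ k \<ge> 1\<close>.\<close>
    also have "\<dots> \<le> ennreal (A * enn2real (BMO_norm \<mu> d \<phi> f) * E ^ k * V x (2 ^ k) * (L x 1 / V x 1))
      + ennreal (norm c * E ^ k * V x (2 ^ k))"
      using A(2)[rule_format, OF f x zero_less_one, of k] E(1) Vk[of k] one_le_power[of E k]
        mult_left_mono[of 1 "E ^ k" "norm c"]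
      unfolding c_def E_def
      by (intro add_mono ennreal_leI mult_right_mono) auto
    also have "\<dots> = ennreal (Q * E ^ k * V x (2 ^ k))"
      using A(1) L_pos[OF x, of 1] V_pos[OF x, of 1] E(1) Vk[of k]
      by (simp add: Q_def algebra_simps flip: ennreal_plus)
    finally show ?thesis .
  qed
  let ?F = "\<lambda>k y. ennreal (C2 / (T ^ k * V x (2 ^ Suc k))) *
    (ennreal (norm (f y)) * indicator (B x (2 ^ Suc k)) y)"
  have "(\<integral>\<^sup>+y. ennreal (norm (f y) / ((1 + d x y) powr \<tau> * V x (1 + d x y))) \<partial>\<mu>) \<le> (\<integral>\<^sup>+y. (\<Sum>k. ?F k y) \<partial>\<mu>)"
  proof (rule nn_integral_mono)
    fix y assume y: "y \<in> space \<mu>"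
    define k where "k = nat \<lfloor>log 2 (1 + d x y)\<rfloor>"
    have d0: "0 \<le> d x y"
      using dist_nonneg x y .
    then have "0 \<le> log 2 (1 + d x y)"
      by simp
    then have k: "real k \<le> log 2 (1 + d x y)" "log 2 (1 + d x y) < real (Suc k)"
      unfolding k_def by linarith+
    have k2: "2 ^ k \<le> 1 + d x y" "1 + d x y < 2 ^ Suc k"
      using k d0 le_log_iff[of 2 "1 + d x y" k] log_less_iff[of 2 "1 + d x y" "Suc k"]
      by (simp_all add: powr_realpow del: power_Suc of_nat_Suc)
    have yB: "y \<in> B x (2 ^ Suc k)"
      using k2 y x d0 dist_sym[OF x y] by (auto simp: qball_def)
    have "T ^ k * (V x (2 ^ Suc k) / C2) \<le> (1 + d x y) powr \<tau> * V x (1 + d x y)"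
    proof (rule mult_mono)
      show "T ^ k \<le> (1 + d x y) powr \<tau>"
        using powr_mono2[OF _ _ k2(1), of \<tau>] e \<beta> unfolding T_def \<tau>_def
        by (simp add: powr_power_commute)
      have "V x (2 ^ Suc k) / C2 \<le> V x (2 ^ k)"
        using C2(2)[rule_format, OF x, of "2 ^ k"] C2(1) by (simp add: field_simps)
      also have "\<dots> \<le> V x (1 + d x y)"
        using k2 by (intro V_mono x) auto
      finally show "V x (2 ^ Suc k) / C2 \<le> V x (1 + d x y)" .
    qed (use Vk[of "Suc k"] C2(1) in auto)
    then have "1 / ((1 + d x y) powr \<tau> * V x (1 + d x y)) \<le> 1 / (T ^ k * (V x (2 ^ Suc k) / C2))"
      using Vk[of "Suc k"] C2(1) E by (intro divide_left_mono mult_pos_pos divide_pos_pos V_pos x) (use d0 in auto)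
    then have "(1 / ((1 + d x y) powr \<tau> * V x (1 + d x y))) * norm (f y)
      \<le> (C2 / (T ^ k * V x (2 ^ Suc k))) * norm (f y)"
      by (intro mult_right_mono) auto
    then have "ennreal (norm (f y) / ((1 + d x y) powr \<tau> * V x (1 + d x y)))
      \<le> ennreal ((C2 / (T ^ k * V x (2 ^ Suc k))) * norm (f y))"
      by (intro ennreal_leI) (simp add: mult.commute)
    also have "\<dots> = ?F k y"
      unfolding ennreal_mult''[OF norm_ge_zero] using yB by simp
    also have "\<dots> \<le> (\<Sum>k. ?F k y)"
      using sum_le_suminf[of "\<lambda>k. ?F k y" "{k}"] by (simp add: summableI)
    finally show "ennreal (norm (f y) / ((1 + d x y) powr \<tau> * V x (1 + d x y))) \<le> (\<Sum>k. ?F k y)" .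
  qed
  also have "\<dots> = (\<Sum>k. \<integral>\<^sup>+y. ?F k y \<partial>\<mu>)"
    by (intro nn_integral_suminf) measurable
  also have "\<dots> \<le> (\<Sum>k. ennreal (C2 * Q * E * (E / T) ^ k))"
  proof (rule suminf_le)
    fix k
    have "(\<integral>\<^sup>+y. ?F k y \<partial>\<mu>) = ennreal (C2 / (T ^ k * V x (2 ^ Suc k))) *
        (\<integral>\<^sup>+y\<in>B x (2 ^ Suc k). ennreal (norm (f y)) \<partial>\<mu>)"
      by (intro nn_integral_cmult) measurable
    also have "\<dots> \<le> ennreal (C2 / (T ^ k * V x (2 ^ Suc k))) * ennreal (Q * E ^ Suc k * V x (2 ^ Suc k))"
      by (intro mult_left_mono f_ball) auto
    also have "\<dots> = ennreal (C2 / (T ^ k * V x (2 ^ Suc k)) * (Q * E ^ Suc k * V x (2 ^ Suc k)))"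
      using C2(1) Vk[of "Suc k"] E by (intro ennreal_mult'[symmetric]) auto
    also have "C2 / (T ^ k * V x (2 ^ Suc k)) * (Q * E ^ Suc k * V x (2 ^ Suc k)) = C2 * Q * E * (E / T) ^ k"
      using Vk[of "Suc k"] by (simp add: power_divide)
    finally show "(\<integral>\<^sup>+y. ?F k y \<partial>\<mu>) \<le> ennreal (C2 * Q * E * (E / T) ^ k)"
      by simp
  qed (auto intro: summableI)
  also have "\<dots> = ennreal (C2 * Q * E * (1 / (1 - E / T)))"
    using C2(1) Q E by (intro suminf_ennreal_eq sums_mult geometric_sums) auto
  finally have "(\<integral>\<^sup>+y. ennreal (norm (f y) / ((1 + d x y) powr \<tau> * V x (1 + d x y))) \<partial>\<mu>) < \<infinity>"
    by (rule le_less_trans) simp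
  then show ?thesis
    using loc by (simp add: growth_class_at_def \<tau>_def V_def)
qed

end

section \<open>Choice of the exponents and the inclusion\<close>

context growth_space
begin

text \<open>The strict inequality for \<open>M\<close> is an open condition: with exponents within
  \<epsilon> of the indices the growth rate is at most \<open>F \<epsilon>\<close>, which tends to
  the critical rate as \<epsilon> tends to 0.\<close>

lemma admissible_exponents_exist:
  assumes M: "critical_index \<mu> d \<phi> < M"
  obtains n \<alpha> q p e \<beta> where "admissible_exponents \<mu> d \<phi> n \<alpha> q p e" "n + e < M"
    "\<beta> \<in> {0<..<M - deg_n \<mu> d - deg_N \<mu> d}"
    "e < deg_n \<mu> d * weight_index \<mu> d \<phi> / lower_index \<mu> \<phi> - deg_\<alpha> \<mu> d + \<beta>"
proof -
  define n\<^sub>0 \<alpha>\<^sub>0 q\<^sub>0 p\<^sub>0 where "n\<^sub>0 = deg_n \<mu> d" and "\<alpha>\<^sub>0 = deg_\<alpha> \<mu> d"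
    and "q\<^sub>0 = weight_index \<mu> d \<phi>" and "p\<^sub>0 = lower_index \<mu> \<phi>"
  define e\<^sub>0 where "e\<^sub>0 = n\<^sub>0 * q\<^sub>0 / p\<^sub>0 - \<alpha>\<^sub>0"
  have bounds: "0 \<le> n\<^sub>0" "1 \<le> q\<^sub>0" "0 < p\<^sub>0" "p\<^sub>0 \<le> 1"
    using deg_n_nonneg weight_index_ge_1 lower_index_bounds
    by (auto simp: n\<^sub>0_def q\<^sub>0_def p\<^sub>0_def)
  have M0: "n\<^sub>0 + e\<^sub>0 < M"
    using M by (simp add: critical_index_def e\<^sub>0_def n\<^sub>0_def \<alpha>\<^sub>0_def q\<^sub>0_def p\<^sub>0_def algebra_simps)
  have "n\<^sub>0 * 1 \<le> n\<^sub>0 * (q\<^sub>0 / p\<^sub>0)"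
    using bounds by (intro mult_left_mono) (auto simp: pos_le_divide_eq)
  then have "deg_N \<mu> d \<le> e\<^sub>0"
    using deg_N_le by (simp add: e\<^sub>0_def n\<^sub>0_def \<alpha>\<^sub>0_def)
  \<comment> \<open>The midpoint of the allowed range, which is nonempty because
    \<open>deg_N\<close> is at most the critical rate.\<close>
  define \<beta> where "\<beta> = (M - n\<^sub>0 - deg_N \<mu> d) / 2"
  have \<beta>: "0 < \<beta>" "\<beta> < M - n\<^sub>0 - deg_N \<mu> d"
    using M0 \<open>deg_N \<mu> d \<le> e\<^sub>0\<close> by (auto simp: \<beta>_def)
  define F where "F \<epsilon> = (n\<^sub>0 + \<epsilon>) * (q\<^sub>0 + \<epsilon>) / (p\<^sub>0 - \<epsilon>) - (\<alpha>\<^sub>0 - \<epsilon>) + \<epsilon>" for \<epsilon> :: real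
  have "(F \<longlongrightarrow> (n\<^sub>0 + 0) * (q\<^sub>0 + 0) / (p\<^sub>0 - 0) - (\<alpha>\<^sub>0 - 0) + 0) (at_right 0)"
    unfolding F_def using bounds by (intro tendsto_intros) auto
  then have F: "(F \<longlongrightarrow> e\<^sub>0) (at_right 0)"
    by (simp add: e\<^sub>0_def)
  have "((\<lambda>\<epsilon>. n\<^sub>0 + \<epsilon> + F \<epsilon>) \<longlongrightarrow> n\<^sub>0 + 0 + e\<^sub>0) (at_right 0)"
    by (intro tendsto_intros F)
  then have "eventually (\<lambda>\<epsilon>. n\<^sub>0 + \<epsilon> + F \<epsilon> < M) (at_right 0)"
    using M0 by (intro order_tendstoD(2)) auto
  moreover have "eventually (\<lambda>\<epsilon>. F \<epsilon> < e\<^sub>0 + \<beta>) (at_right 0)"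
    using \<beta> by (intro order_tendstoD(2)[OF F]) auto
  moreover have "eventually (\<lambda>\<epsilon>. 0 < \<epsilon> \<and> \<epsilon> < p\<^sub>0) (at_right 0)"
    using bounds by (auto simp: eventually_at_right_field)
  ultimately have "eventually (\<lambda>\<epsilon>. n\<^sub>0 + \<epsilon> + F \<epsilon> < M \<and> F \<epsilon> < e\<^sub>0 + \<beta> \<and> 0 < \<epsilon> \<and> \<epsilon> < p\<^sub>0) (at_right 0)"
    by eventually_elim auto
  then obtain \<epsilon> where \<epsilon>: "n\<^sub>0 + \<epsilon> + F \<epsilon> < M" "F \<epsilon> < e\<^sub>0 + \<beta>" "0 < \<epsilon>" "\<epsilon> < p\<^sub>0"
    using eventually_happens'[OF trivial_limit_at_right_real] by blast
  have less: "deg_n \<mu> d < n\<^sub>0 + \<epsilon>" "\<alpha>\<^sub>0 - \<epsilon> < deg_\<alpha> \<mu> d" "weight_index \<mu> d \<phi> < q\<^sub>0 + \<epsilon>"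
    "p\<^sub>0 - \<epsilon> < lower_index \<mu> \<phi>"
    using \<epsilon> by (auto simp: n\<^sub>0_def \<alpha>\<^sub>0_def q\<^sub>0_def p\<^sub>0_def)
  obtain n where n: "0 < n" "cond_D \<mu> d n" "n < n\<^sub>0 + \<epsilon>"
    by (rule deg_n_approx[OF less(1)])
  obtain \<alpha> where \<alpha>: "0 \<le> \<alpha>" "\<alpha> \<le> n" "cond_R \<mu> d \<alpha>" "\<alpha>\<^sub>0 - \<epsilon> < \<alpha>"
    using deg_\<alpha>_approx[OF less(2)] n(1,2) by metis
  obtain q where q: "1 \<le> q" "muckenhoupt \<mu> d q \<phi>" "q < q\<^sub>0 + \<epsilon>"
    by (rule weight_index_approx[OF less(3)])
  obtain p where p: "0 < p" "lower_type \<mu> \<phi> p" "p\<^sub>0 - \<epsilon> < p"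
    by (rule lower_index_approx[OF less(4)])
  have p1: "p \<le> 1"
    using lower_type_le_1 p by blast
  \<comment> \<open>The added \<epsilon> keeps \<open>e\<close> positive even if
    \<open>n * q / p\<close> equals \<alpha>.\<close>
  define e where "e = n * q / p - \<alpha> + \<epsilon>"
  have "n * 1 \<le> n * (q / p)"
    using n q p p1 by (intro mult_left_mono) (auto simp: pos_le_divide_eq)
  then have "0 < e"
    using \<alpha> \<epsilon> by (simp add: e_def)
  have "n * q / p \<le> (n\<^sub>0 + \<epsilon>) * (q\<^sub>0 + \<epsilon>) / (p\<^sub>0 - \<epsilon>)"
    using n q p \<epsilon> by (intro frac_le mult_mono) auto
  then have "e \<le> F \<epsilon>"
    using \<alpha> by (simp add: e_def F_def)
  have "admissible_exponents \<mu> d \<phi> n \<alpha> q p e"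
    using n \<alpha> q p \<open>0 < e\<close> \<epsilon> by unfold_locales (auto simp: e_def)
  then show thesis
    using that[of n \<alpha> q p e \<beta>] \<beta> \<epsilon> n \<open>e \<le> F \<epsilon>\<close>
    by (simp add: n\<^sub>0_def \<alpha>\<^sub>0_def q\<^sub>0_def p\<^sub>0_def e\<^sub>0_def)
qed

lemma BMO_inclusion:
  fixes a :: "real \<Rightarrow> 'a \<Rightarrow> 'a \<Rightarrow> 'k::{real_normed_field,banach,second_countable_topology}"
  assumes approx: "generalized_approx_identity \<mu> d \<phi> M m g a"
    and one: "\<forall>t>0. AE x in \<mu>. (LINT y|\<mu>. a t x y) = 1"
  shows "BMO \<mu> d \<phi> \<subseteq> BMO_A \<mu> d \<phi> M m a"
    and "\<exists>C>0. \<forall>f\<in>BMO \<mu> d \<phi>. BMO_A_norm \<mu> d \<phi> m a f \<le> ennreal C * BMO_norm \<mu> d \<phi> f"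
proof -
  have "critical_index \<mu> d \<phi> < M"
    using approx by (simp add: generalized_approx_identity_def)
  then obtain n \<alpha> q p e \<beta> where adm: "admissible_exponents \<mu> d \<phi> n \<alpha> q p e" "n + e < M"
    and \<beta>: "\<beta> \<in> {0<..<M - deg_n \<mu> d - deg_N \<mu> d}"
      "e < deg_n \<mu> d * weight_index \<mu> d \<phi> / lower_index \<mu> \<phi> - deg_\<alpha> \<mu> d + \<beta>"
    by (rule admissible_exponents_exist)
  interpret kernel_setting \<mu> d \<phi> n \<alpha> q p e M m g a
    using adm approx by (simp add: kernel_setting_def kernel_setting_axioms_def)
  show C: "\<exists>C>0. \<forall>f\<in>BMO \<mu> d \<phi>. BMO_A_norm \<mu> d \<phi> m a f \<le> ennreal C * BMO_norm \<mu> d \<phi> f"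
    by (rule BMO_A_norm_le[OF one])
  show "BMO \<mu> d \<phi> \<subseteq> BMO_A \<mu> d \<phi> M m a"
  proof
    fix f :: "'a \<Rightarrow> 'k" assume f: "f \<in> BMO \<mu> d \<phi>"
    obtain x where x: "x \<in> space \<mu>"
      using space_nonempty by blast
    have "f \<in> growth_class_at \<mu> d \<phi> x \<beta>"
      using f x \<beta>(2) by (rule BMO_subset_growth_class_at)
    then have "f \<in> growth_class \<mu> d \<phi> M"
      unfolding growth_class_def using x \<beta>(1) by blast
    moreover have "\<forall>t>0. AE x in \<mu>. integrable \<mu> (\<lambda>y. a t x y * f y)"
      using approx_op_integrable[OF f] one by blast
    moreover obtain C where "BMO_A_norm \<mu> d \<phi> m a f \<le> ennreal C * BMO_norm \<mu> d \<phi> f"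
      using C f by blast
    then have "BMO_A_norm \<mu> d \<phi> m a f < \<infinity>"
      using f by (auto simp: BMO_def ennreal_mult_less_top intro: le_less_trans)
    ultimately show "f \<in> BMO_A \<mu> d \<phi> M m a"
      by (simp add: BMO_A_def)
  qed
qed

end

section \<open>The two-point space\<close>

text \<open>Realised inside the reals to fit the type of the measure in the existential statement.
  Every ball has measure 1 or 2.\<close>

abbreviation two_points :: "real measure" where
  "two_points \<equiv> count_space {0, 1}"

abbreviation line_dist :: "real \<Rightarrow> real \<Rightarrow> real" where
  "line_dist x y \<equiv> \<bar>x - y\<bar>"

lemma two_points_ball:
  assumes "x \<in> {0, 1}" "0 < r"
  shows "emeasure two_points (qball two_points line_dist x r) \<in> {1, 2}"
    and "measure two_points (qball two_points line_dist x r) \<in> {1, 2}"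
    and "1 < r \<Longrightarrow> qball two_points line_dist x r = {0, 1}"
proof -
  have "x \<in> qball two_points line_dist x r" "qball two_points line_dist x r \<subseteq> {0, 1}"
    using assms by (auto simp: qball_def)
  then consider "qball two_points line_dist x r = {0}" | "qball two_points line_dist x r = {1}"
    | "qball two_points line_dist x r = {0, 1}"
    by blast
  then show *: "emeasure two_points (qball two_points line_dist x r) \<in> {1, 2}"
    by cases simp_all
  then show "measure two_points (qball two_points line_dist x r) \<in> {1, 2}"
    unfolding measure_def by auto
  show "1 < r \<Longrightarrow> qball two_points line_dist x r = {0, 1}"
    using assms by (auto simp: qball_def)
qed

lemma two_points_homogeneous: "homogeneous_type two_points line_dist"
proof -
  have "{U. quasi_metric_open two_points line_dist U} = Pow {0, 1}"
  proof (intro equalityI subsetI)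
    fix U :: "real set" assume U: "U \<in> Pow {0, 1}"
    \<comment> \<open>Balls of radius 1 are singletons since the defining inequality is strict, so
      every subset is open.\<close>
    have "qball two_points line_dist x 1 \<subseteq> U" if "x \<in> U" for x
      using that U by (auto simp: qball_def)
    with U show "U \<in> {U. quasi_metric_open two_points line_dist U}"
      unfolding quasi_metric_open_def by (auto intro!: exI[of _ 1])
  qed (auto simp: quasi_metric_open_def)
  moreover have "quasi_metric_on {0, 1} line_dist"
    unfolding quasi_metric_on_def by (intro conjI exI[of _ 1]) auto
  moreover have "emeasure two_points (qball two_points line_dist x (2 * r))
      \<le> ennreal 2 * emeasure two_points (qball two_points line_dist x r)" if "x \<in> {0, 1}" "0 < r" for x r
    using two_points_ball(1)[of x r] two_points_ball(1)[of x "2 * r"] that by auto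
  moreover have "0 < emeasure two_points (qball two_points line_dist x r)"
    "emeasure two_points (qball two_points line_dist x r) < \<infinity>"
    "qball two_points line_dist x r \<in> Pow {0, 1}" if "x \<in> {0, 1}" "0 < r" for x r
    using two_points_ball(1)[of x r] that by (auto simp: qball_def)
  ultimately show ?thesis
    unfolding homogeneous_type_def sets_count_space space_count_space
    using sets.sigma_sets_eq[of two_points] by (intro conjI exI[of _ 2]) auto
qed

text \<open>A weight that is constant in \<open>x\<close> has Muckenhoupt product exactly 1 on every
  ball.\<close>

lemma identity_growth_function: "growth_function two_points line_dist (\<lambda>x t. t)"
proof -
  have "nn_average two_points (qball two_points line_dist x r) (\<lambda>y. ennreal t) *
      esssup (restrict_space two_points (qball two_points line_dist x r)) (\<lambda>y. ennreal (inverse t)) = 1"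
    if "x \<in> {0, 1}" "0 < r" "0 < t" for x r t
  proof -
    define Q where "Q = qball two_points line_dist x r"
    have Q: "emeasure two_points Q \<in> {1, 2}" "Q \<subseteq> {0, 1}"
      using two_points_ball(1)[OF that(1,2)] by (auto simp: Q_def qball_def)
    have "emeasure two_points Q \<noteq> 0" "emeasure two_points Q < top"
      using Q(1) by auto
    then have "nn_average two_points Q (\<lambda>y. ennreal t) = ennreal t"
      using Q by (simp add: nn_average_def nn_integral_cmult_indicator ennreal_mult_divide_eq)
    moreover have "esssup (restrict_space two_points Q) (\<lambda>y. ennreal (inverse t)) = ennreal (inverse t)"
      using Q by (intro esssup_const) (auto simp: emeasure_restrict_space space_restrict_space Int_absorb2)
    ultimately show ?thesis
      using that(3) by (simp add: Q_def flip: ennreal_mult)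
  qed
  then have "muckenhoupt two_points line_dist 1 (\<lambda>x t. t)"
    unfolding muckenhoupt_def by (intro le_less_trans[OF SUP_least[of _ _ 1]] SUP_least) auto
  moreover have "orlicz (\<lambda>t. t)"
    by (simp add: orlicz_def mono_on_def filterlim_ident)
  moreover have "upper_type two_points (\<lambda>x t. t) 1" "lower_type two_points (\<lambda>x t. t) 1"
    unfolding upper_type_def lower_type_def by (intro exI[of _ 1]; simp)+
  ultimately show ?thesis
    unfolding growth_function_def by (auto intro: exI[of _ 1] bexI[of _ 1])
qed

text \<open>For counting measure this kernel represents the identity operator. On the diagonal it
  has to be at most \<open>g 0\<close> over the measure of a ball, which is at most 2; this explains
  the factor 2 in \<open>g\<close>. Exponential decay beats every power, so \<open>k\<close> is
  free.\<close>

lemma kronecker_approx_identity: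
  assumes "critical_index two_points line_dist (\<lambda>x t. t) < real k"
  shows "generalized_approx_identity two_points line_dist (\<lambda>x t. t) (real k) 1 (\<lambda>r. 2 * exp (- r))
    (\<lambda>t x y. if x = y then 1 else 0 :: 'k::{real_normed_field,banach,second_countable_topology})"
proof -
  have "((\<lambda>r::real. 2 * (r ^ k / exp r)) \<longlongrightarrow> 2 * 0) at_top"
    by (intro tendsto_intros tendsto_power_div_exp_0)
  moreover have "eventually (\<lambda>r::real. 2 * (r ^ k / exp r) = r powr real k * (2 * exp (- (r powr 1)))) at_top"
    using eventually_gt_at_top[of 0]
    by eventually_elim (simp add: powr_realpow exp_minus field_simps)
  ultimately have "((\<lambda>r::real. r powr real k * (2 * exp (- (r powr 1)))) \<longlongrightarrow> 0) at_top"
    using tendsto_cong by force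
  moreover have "bounded ((\<lambda>r::real. 2 * exp (- r)) ` {0..})"
    by (intro boundedI[of _ 2]) auto
  moreover have "antimono_on {0..} (\<lambda>r::real. 2 * exp (- r))"
    by (auto simp: monotone_on_def)
  moreover have "(\<lambda>(x, y). if x = y then 1 else 0 :: 'k) \<in> borel_measurable (two_points \<Otimes>\<^sub>M two_points)"
    by (subst pair_measure_countable) auto
  moreover have "norm (if x = y then 1 else 0 :: 'k) \<le>
      2 * exp (- (line_dist x y powr 1 / t)) / measure two_points (qball two_points line_dist x (t powr (1 / 1)))"
    if "0 < t" "x \<in> {0, 1}" "y \<in> {0, 1}" for t x y
    using two_points_ball(2)[of x t] that by auto
  ultimately show ?thesis
    using assms unfolding generalized_approx_identity_def space_count_space by simp
qed

text \<open>Since the operators fix \<open>f\<close> pointwise, its norm adapted to them vanishes,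
  although \<open>f\<close> is not constant and so oscillates on the ball that is the whole space.
  The bound on \<open>M\<close> makes a choice of \<beta> possible.\<close>

lemma two_points_no_reverse_inequality:
  fixes f :: "real \<Rightarrow> 'k::{real_normed_field,banach,second_countable_topology}"
  defines "a \<equiv> \<lambda>(t::real) (x::real) (y::real). if x = y then 1 else 0 :: 'k"
    and "f \<equiv> \<lambda>x. if x = 1 then 1 else 0"
  assumes M: "deg_n two_points line_dist + deg_N two_points line_dist < M"
  shows "f \<in> BMO_A two_points line_dist (\<lambda>x t. t) M 1 a"
    and "BMO_A_norm two_points line_dist (\<lambda>x t. t) 1 a f = 0"
    and "0 < BMO_norm two_points line_dist (\<lambda>x t. t) f"
proof -
  interpret growth_space two_points line_dist "\<lambda>x t. t"
    by unfold_locales (auto intro: two_points_homogeneous identity_growth_function)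
  have int: "integrable two_points h" for h :: "real \<Rightarrow> 'k"
    by (intro integrable_count_space) auto
  have id: "approx_op two_points a t f x = f x" if "x \<in> {0, 1}" for x t
    using that by (auto simp: approx_op_def lebesgue_integral_count_space_finite a_def)
  have zero: "(\<integral>\<^sup>+y\<in>B x r. ennreal (norm (f y - approx_op two_points a (r powr 1) f y)) \<partial>two_points) = 0" for x r
    by (subst nn_integral_cong[of _ _ "\<lambda>_. 0"]) (auto simp: id)
  then show norm0: "BMO_A_norm two_points line_dist (\<lambda>x t. t) 1 a f = 0"
    unfolding BMO_A_norm_def zero by simp
  define \<beta> where "\<beta> = (M - deg_n two_points line_dist - deg_N two_points line_dist) / 2"
  have \<beta>: "\<beta> \<in> {0<..<M - deg_n two_points line_dist - deg_N two_points line_dist}"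
    using M by (auto simp: \<beta>_def)
  have "locally_integrable two_points line_dist f"
    unfolding locally_integrable_def set_integrable_def using int by blast
  then have "f \<in> growth_class_at two_points line_dist (\<lambda>x t. t) 0 \<beta>"
    by (simp add: growth_class_at_def nn_integral_count_space_finite)
  then have "f \<in> growth_class two_points line_dist (\<lambda>x t. t) M"
    unfolding growth_class_def using \<beta> by auto
  then show "f \<in> BMO_A two_points line_dist (\<lambda>x t. t) M 1 a"
    using norm0 int by (auto simp: BMO_A_def)
  define c where "c = mean two_points (B 0 2) f"
  have ball: "B 0 2 = {0, 1}"
    by (intro two_points_ball(3)) auto
  \<comment> \<open>This holds for every \<open>c\<close>, so the mean need not be computed.\<close>
  have "1 \<le> norm (f 0 - c) + norm (f 1 - c)"
    using norm_triangle_ineq4[of "f 0 - c" "f 1 - c"] by (simp add: f_def)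
  then have "(0::ennreal) < ennreal (norm (f 0 - c) + norm (f 1 - c))"
    by (simp only: ennreal_less_zero_iff)
  also have "\<dots> = (\<integral>\<^sup>+y\<in>B 0 2. ennreal (norm (f y - c)) \<partial>two_points)"
    by (simp add: nn_integral_count_space_finite ball)
  finally have "0 < (\<integral>\<^sup>+y\<in>B 0 2. ennreal (norm (f y - c)) \<partial>two_points) / lux 0 2"
    using lux_pos_finite(2)[of 0 2] by (simp add: ennreal_zero_less_divide)
  also have "\<dots> \<le> BMO_norm two_points line_dist (\<lambda>x t. t) f"
    unfolding BMO_norm_def c_def
    by (rule SUP_upper2[of 0], simp, rule SUP_upper2[of 2]) auto
  finally show "0 < BMO_norm two_points line_dist (\<lambda>x t. t) f" .
qed

section \<open>The two assertions combined\<close>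

theorem proposition3p5:
  shows
  "(\<forall>(\<mu> :: 'a measure) (d :: 'a \<Rightarrow> 'a \<Rightarrow> real) (\<phi> :: 'a \<Rightarrow> real \<Rightarrow> real) (M :: real) (m :: real)
      (g :: real \<Rightarrow> real)
      (a :: real \<Rightarrow> 'a \<Rightarrow> 'a \<Rightarrow> 'k::{real_normed_field,banach,second_countable_topology}).
      homogeneous_type \<mu> d \<and> growth_function \<mu> d \<phi> \<and>
      generalized_approx_identity \<mu> d \<phi> M m g a \<and>
      (\<forall>t>0. AE x in \<mu>. (LINT y|\<mu>. a t x y) = 1) \<longrightarrow>
      BMO \<mu> d \<phi> \<subseteq> BMO_A \<mu> d \<phi> M m a \<and>
      (\<exists>C::real. C > 0 \<and>
         (\<forall>f\<in>BMO \<mu> d \<phi>. BMO_A_norm \<mu> d \<phi> m a f \<le> ennreal C * BMO_norm \<mu> d \<phi> f)))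
   \<and>
   (\<exists>(\<mu> :: real measure) (d :: real \<Rightarrow> real \<Rightarrow> real) (\<phi> :: real \<Rightarrow> real \<Rightarrow> real) (M :: real) (m :: real)
      (g :: real \<Rightarrow> real) (a :: real \<Rightarrow> real \<Rightarrow> real \<Rightarrow> 'k).
      homogeneous_type \<mu> d \<and> growth_function \<mu> d \<phi> \<and>
      generalized_approx_identity \<mu> d \<phi> M m g a \<and>
      (\<forall>t>0. AE x in \<mu>. (LINT y|\<mu>. a t x y) = 1) \<and>
      \<not> (\<exists>C::real. \<forall>f\<in>BMO_A \<mu> d \<phi> M m a.
            BMO_norm \<mu> d \<phi> f \<le> ennreal C * BMO_A_norm \<mu> d \<phi> m a f))"
proof (rule conjI, goal_cases)
  case 1
  show ?case
  proof (intro allI impI, elim conjE)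
    fix \<mu> :: "'a measure" and d \<phi> M m g and a :: "real \<Rightarrow> 'a \<Rightarrow> 'a \<Rightarrow> 'k"
    assume "homogeneous_type \<mu> d" "growth_function \<mu> d \<phi>"
      and approx: "generalized_approx_identity \<mu> d \<phi> M m g a"
        "\<forall>t>0. AE x in \<mu>. (LINT y|\<mu>. a t x y) = 1"
    then interpret growth_space \<mu> d \<phi>
      by unfold_locales
    show "BMO \<mu> d \<phi> \<subseteq> BMO_A \<mu> d \<phi> M m a \<and>
      (\<exists>C::real. C > 0 \<and>
         (\<forall>f\<in>BMO \<mu> d \<phi>. BMO_A_norm \<mu> d \<phi> m a f \<le> ennreal C * BMO_norm \<mu> d \<phi> f))"
      using BMO_inclusion[OF approx] by blast
  qed
next
  case 2
  let ?\<phi> = "\<lambda>(x::real) (t::real). t"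
  let ?a = "\<lambda>(t::real) (x::real) (y::real). if x = y then 1 else 0 :: 'k"
  let ?f = "\<lambda>x::real. if x = 1 then 1 else 0 :: 'k"
  \<comment> \<open>Exceeding the first number makes the kernel admissible, exceeding the second
    puts the test function into the growth class.\<close>
  obtain k :: nat where k: "max (critical_index two_points line_dist ?\<phi>)
      (deg_n two_points line_dist + deg_N two_points line_dist) < real k"
    using reals_Archimedean2 by blast
  have "\<not> (\<exists>C::real. \<forall>f\<in>BMO_A two_points line_dist ?\<phi> (real k) 1 ?a.
      BMO_norm two_points line_dist ?\<phi> f \<le> ennreal C * BMO_A_norm two_points line_dist ?\<phi> 1 ?a f)"
  proof
    assume "\<exists>C::real. \<forall>f\<in>BMO_A two_points line_dist ?\<phi> (real k) 1 ?a.
      BMO_norm two_points line_dist ?\<phi> f \<le> ennreal C * BMO_A_norm two_points line_dist ?\<phi> 1 ?a f"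
    then obtain C where "BMO_norm two_points line_dist ?\<phi> ?f
        \<le> ennreal C * BMO_A_norm two_points line_dist ?\<phi> 1 ?a ?f"
      using two_points_no_reverse_inequality(1)[of "real k", where 'k='k] k by auto
    then show False
      using two_points_no_reverse_inequality(2,3)[of "real k", where 'k='k] k by simp
  qed
  moreover have "\<forall>t>0. AE x in two_points. (LINT y|two_points. ?a t x y) = 1"
    by (auto simp: AE_count_space lebesgue_integral_count_space_finite)
  moreover have "generalized_approx_identity two_points line_dist ?\<phi> (real k) 1 (\<lambda>r. 2 * exp (- r)) ?a"
    using k by (intro kronecker_approx_identity) auto
  ultimately show ?case
    using two_points_homogeneous identity_growth_function by blast
qed

end
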